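(* Let $f(\cdot;i):\mathbb{R}^d\to\mathbb{R}$, $i\in[n]$, and $F(w)=\frac1n\sum_{i=1}^n f(w;i)$. Assume: (a) $\mathrm{dom}(F)\neq\emptyset$ and $F_*:=\inf_{w\in\mathbb{R}^d}F(w)>-\infty$; (b) there is $L>0$ such that for every $i\in[n]$ and all $w,w'\in\mathrm{dom}(F)$, $\|\nabla f(w;i)-\nabla f(w';i)\|\le L\|w-w'\|$; (c) there are finite constants $\Theta,\sigma\ge 0$ such that for all $w\in\mathrm{dom}(F)$, $\frac1n\sum_{i=1}^n\|\nabla f(w;i)-\nabla F(w)\|^2\le\Theta\|\nabla F(w)\|^2+\sigma^2$. Let $0\le\beta<1$ and $D:=\max\left(\frac53,\frac{6(5-3\beta)(\Theta+n)}{n(1-\beta)}\right)$. Fix the number of epochs $T\ge1$ and run the SMG algorithm (described in the context) under the randomized reshuffling strategy, with momentum weight $\beta$ and constant learning rate $\eta_t:=\frac{\gamma n^{1/3}}{T^{1/3}}$ for some $\gamma>0$ such that $\frac{\gamma n^{1/3}}{T^{1/3}}\le\frac{1}{L\sqrt D}$. Then $$\mathbb{E}\big[\|\nabla F(\hat w_T)\|^2\big]\le\frac{1}{n^{1/3}T^{2/3}}\left(\frac{4[F(\tilde w_0)-F_*]}{(1-\beta)\gamma}+\frac{6\sigma^2(5-3\beta)L^2\gamma^2}{1-\beta}\right).$$ Consequently, the convergence rate of the algorithm is $\mathcal{O}(n^{-1/3}T^{-2/3})$ in epoch.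
   Context: $[n]=\{1,\dots,n\}$; $\|\cdot\|$ is the Euclidean norm; $\mathbb{E}$ is expectation over all randomness (permutations and output). Since each $f(\cdot;i)$ is real-valued on $\mathbb{R}^d$, $\mathrm{dom}(F)=\mathbb{R}^d$; each $f(\cdot;i)$ is differentiable. SMG algorithm (Shuffling Momentum Gradient), with parameters $\beta$, number of epochs $T\ge1$, and $\eta_t$: Choose $\tilde w_0\in\mathbb{R}^d$ (deterministic) and set $\tilde m_0:=0$. For $t=1,\dots,T$: set $w_0^{(t)}:=\tilde w_{t-1}$, $m_0^{(t)}:=\tilde m_{t-1}$, $v_0^{(t)}:=0$; generate a permutation $\pi^{(t)}$ of $[n]$; for $i=0,\dots,n-1$ put $g_i^{(t)}:=\nabla f(w_i^{(t)};\pi^{(t)}(i+1))$ and $$m_{i+1}^{(t)}:=\beta m_0^{(t)}+(1-\beta)g_i^{(t)},\quad v_{i+1}^{(t)}:=v_i^{(t)}+\tfrac1n g_i^{(t)},\quad w_{i+1}^{(t)}:=w_i^{(t)}-\tfrac{\eta_t}{n}m_{i+1}^{(t)};$$ then set $\tilde w_t:=w_n^{(t)}$ and $\tilde m_t:=v_n^{(t)}$. Output: $\hat w_T\in\{\tilde w_0,\dots,\tilde w_{T-1}\}$ chosen at random (independently of the permutations) with probability $\mathbb{P}[\hat w_T=\tilde w_{t-1}]=\eta_t/\sum_{s=1}^T\eta_s$. Randomized reshuffling strategy: at each epoch $t$, $\pi^{(t)}=(\pi^{(t)}(1),\dots,\pi^{(t)}(n))$ is uniformly sampled at random without replacement from $\{1,\dots,n\}$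 (a uniformly random permutation), independently of the previous epochs. *)

theory Defs
  imports
    "HOL-Probability.Probability"
    "HOL-Combinatorics.Permutations"
    "HOL-Library.Landau_Symbols"
begin

definition grad :: "('a::real_inner \<Rightarrow> real) \<Rightarrow> 'a \<Rightarrow> 'a" where
  "grad f w = (THE g. GDERIV f w :> g)"

(* Components are indexed by {1..n}; values of f outside this range are never used. *)
definition avg_fun :: "nat \<Rightarrow> (nat \<Rightarrow> 'a \<Rightarrow> real) \<Rightarrow> 'a \<Rightarrow> real" where
  "avg_fun n f w = (1 / real n) * (\<Sum>i = 1..n. f i w)"

definition inf_val :: "nat \<Rightarrow> (nat \<Rightarrow> 'a \<Rightarrow> real) \<Rightarrow> real" where
  "inf_val n f = (INF w. avg_fun n f w)"

(* The functions are total, so dom F is the whole space and its nonemptiness is automatic. *)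
definition smg_problem ::
    "nat \<Rightarrow> (nat \<Rightarrow> 'a::euclidean_space \<Rightarrow> real) \<Rightarrow> real \<Rightarrow> real \<Rightarrow> real \<Rightarrow> bool" where
  "smg_problem n f L \<Theta> \<sigma> \<longleftrightarrow>
     n \<ge> 1 \<and>
     (\<forall>i\<in>{1..n}. \<forall>w. f i differentiable (at w)) \<and>
     bdd_below (range (avg_fun n f)) \<and>
     (\<forall>i\<in>{1..n}. \<forall>w w'. norm (grad (f i) w - grad (f i) w') \<le> L * norm (w - w')) \<and>
     (\<forall>w. (1 / real n) * (\<Sum>i = 1..n. (norm (grad (f i) w - grad (avg_fun n f) w))\<^sup>2)
            \<le> \<Theta> * (norm (grad (avg_fun n f) w))\<^sup>2 + \<sigma>\<^sup>2)"

(* The state (w_i, m_i, v_i) after i inner steps of one epoch with permutation p and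
   learning rate \<eta>, started at w0 with momentum m0.  The momentum update always refers
   to m0, the momentum at the start of the epoch. *)
fun smg_inner ::
    "nat \<Rightarrow> (nat \<Rightarrow> 'a::euclidean_space \<Rightarrow> real) \<Rightarrow> real \<Rightarrow> real \<Rightarrow> (nat \<Rightarrow> nat)
       \<Rightarrow> 'a \<Rightarrow> 'a \<Rightarrow> nat \<Rightarrow> 'a \<times> 'a \<times> 'a" where
  "smg_inner n f \<beta> \<eta> p w0 m0 0 = (w0, m0, 0)"
| "smg_inner n f \<beta> \<eta> p w0 m0 (Suc i) =
     (let (w, m, v) = smg_inner n f \<beta> \<eta> p w0 m0 i;
          g = grad (f (p (i + 1))) w;
          m' = \<beta> *\<^sub>R m0 + (1 - \<beta>) *\<^sub>R g;
          v' = v + (1 / real n) *\<^sub>R g;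
          w' = w - (\<eta> / real n) *\<^sub>R m'
      in (w', m', v'))"

(* The pair (outer iterate, outer momentum) after t epochs, for given permutations \<pi> 1, \<pi> 2, \<dots> *)
fun smg_outer ::
    "nat \<Rightarrow> (nat \<Rightarrow> 'a::euclidean_space \<Rightarrow> real) \<Rightarrow> real \<Rightarrow> (nat \<Rightarrow> real) \<Rightarrow> (nat \<Rightarrow> nat \<Rightarrow> nat)
       \<Rightarrow> 'a \<Rightarrow> nat \<Rightarrow> 'a \<times> 'a" where
  "smg_outer n f \<beta> \<eta> \<pi> w0 0 = (w0, 0)"
| "smg_outer n f \<beta> \<eta> \<pi> w0 (Suc t) =
     (let (w, m) = smg_outer n f \<beta> \<eta> \<pi> w0 t;
          (w', m', v') = smg_inner n f \<beta> (\<eta> (t + 1)) (\<pi> (t + 1)) w m n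
      in (w', v'))"

definition smg_iterate ::
    "nat \<Rightarrow> (nat \<Rightarrow> 'a::euclidean_space \<Rightarrow> real) \<Rightarrow> real \<Rightarrow> (nat \<Rightarrow> real) \<Rightarrow> (nat \<Rightarrow> nat \<Rightarrow> nat)
       \<Rightarrow> 'a \<Rightarrow> nat \<Rightarrow> 'a" where
  "smg_iterate n f \<beta> \<eta> \<pi> w0 t = fst (smg_outer n f \<beta> \<eta> \<pi> w0 t)"

(* Independent uniformly random permutations of {1..n} for the epochs 1, \<dots>, T;
   the default value id is only taken outside {1..T}. *)
definition rr_perms :: "nat \<Rightarrow> nat \<Rightarrow> (nat \<Rightarrow> nat \<Rightarrow> nat) pmf" where
  "rr_perms n T = Pi_pmf {1..T} id (\<lambda>_. pmf_of_set {p. p permutes {1..n}})"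

(* The distribution of the index of the returned epoch.  Note that embed_pmf yields the
   intended weights only for a genuine probability vector, see pmf_output_index. *)
definition output_index :: "(nat \<Rightarrow> real) \<Rightarrow> nat \<Rightarrow> nat pmf" where
  "output_index \<eta> T = embed_pmf (\<lambda>t. if t \<in> {1..T} then \<eta> t / (\<Sum>s = 1..T. \<eta> s) else 0)"

lemma pmf_output_index:
  assumes "T \<ge> 1" and pos: "\<And>t. t \<in> {1..T} \<Longrightarrow> \<eta> t > 0"
  shows "pmf (output_index \<eta> T) t = (if t \<in> {1..T} then \<eta> t / (\<Sum>s = 1..T. \<eta> s) else 0)"
proof -
  let ?g = "\<lambda>t. if t \<in> {1..T} then \<eta> t / (\<Sum>s = 1..T. \<eta> s) else 0"
  have S: "(\<Sum>s = 1..T. \<eta> s) > 0"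
    using assms by (intro sum_pos) auto
  have nonneg: "?g s \<ge> 0" for s
    using pos[of s] S by (auto intro!: divide_nonneg_pos less_imp_le)
  have "(\<integral>\<^sup>+ s. ennreal (?g s) \<partial>count_space UNIV) = (\<Sum>s = 1..T. ennreal (?g s))"
    by (rule nn_integral_count_space') auto
  also have "\<dots> = ennreal (\<Sum>s = 1..T. ?g s)"
    by (rule sum_ennreal) (rule nonneg)
  also have "(\<Sum>s = 1..T. ?g s) = (\<Sum>s = 1..T. \<eta> s / (\<Sum>s = 1..T. \<eta> s))"
    by (intro sum.cong) auto
  also have "\<dots> = 1"
    using S by (simp flip: sum_divide_distrib)
  finally show ?thesis
    unfolding output_index_def by (intro pmf_embed_pmf nonneg) simp
qed

(* The law of the output, the returned index being independent of the permutations. *)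
definition smg_output ::
    "nat \<Rightarrow> (nat \<Rightarrow> 'a::euclidean_space \<Rightarrow> real) \<Rightarrow> real \<Rightarrow> (nat \<Rightarrow> real) \<Rightarrow> nat \<Rightarrow> 'a \<Rightarrow> 'a pmf" where
  "smg_output n f \<beta> \<eta> T w0 =
     map_pmf (\<lambda>(\<pi>, t). smg_iterate n f \<beta> \<eta> \<pi> w0 (t - 1))
       (pair_pmf (rr_perms n T) (output_index \<eta> T))"

definition step_size :: "nat \<Rightarrow> real \<Rightarrow> nat \<Rightarrow> real" where
  "step_size n \<gamma> T = \<gamma> * real n powr (1/3) / real T powr (1/3)"

definition expected_sq_grad ::
    "nat \<Rightarrow> (nat \<Rightarrow> 'a::euclidean_space \<Rightarrow> real) \<Rightarrow> real \<Rightarrow> real \<Rightarrow> nat \<Rightarrow> 'a \<Rightarrow> real" where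
  "expected_sq_grad n f \<beta> \<gamma> T w0 =
     measure_pmf.expectation (smg_output n f \<beta> (\<lambda>_. step_size n \<gamma> T) T w0)
       (\<lambda>w. (norm (grad (avg_fun n f) w))\<^sup>2)"

definition smg_D :: "nat \<Rightarrow> real \<Rightarrow> real \<Rightarrow> real" where
  "smg_D n \<beta> \<Theta> = max (5/3) (6 * (5 - 3 * \<beta>) * (\<Theta> + real n) / (real n * (1 - \<beta>)))"

end

theory Submission
  imports Defs
begin

text \<open>
  Write \<open>w\<^sub>k\<close> and \<open>m\<^sub>k\<close> for iterate and momentum after \<open>k\<close> epochs, \<open>\<eta>\<close> for the constant step,
  \<open>u\<^sub>k = \<beta> m\<^sub>k + (1 - \<beta>) m\<^sub>k\<^sub>+\<^sub>1\<close>, and \<open>A\<^sub>k\<close> for the mean squared distance of the inner points of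
  epoch \<open>k + 1\<close> from \<open>w\<^sub>k\<close>.  A whole epoch moves by \<open>w\<^sub>k\<^sub>+\<^sub>1 = w\<^sub>k - \<eta> u\<^sub>k\<close>, an inexact gradient step.

  Smoothness of \<open>F\<close> gives
  \<open>F(w\<^sub>k\<^sub>+\<^sub>1) \<le> F(w\<^sub>k) - (\<eta>/2) (|\<nabla>F(w\<^sub>k)|\<^sup>2 - |\<nabla>F(w\<^sub>k) - u\<^sub>k|\<^sup>2 + (1 - L \<eta>) |u\<^sub>k|\<^sup>2)\<close>.
  By convexity the error \<open>|\<nabla>F(w\<^sub>k) - u\<^sub>k|\<^sup>2\<close> splits into the errors of \<open>m\<^sub>k\<close> and \<open>m\<^sub>k\<^sub>+\<^sub>1\<close>.  The latter
  averages component gradients at the inner points, so its squared error is at most \<open>L\<^sup>2 A\<^sub>k\<close>; the error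
  of \<open>m\<^sub>k\<close> is controlled by \<open>A\<^sub>k\<^sub>-\<^sub>1\<close> and by the last move \<open>\<eta> u\<^sub>k\<^sub>-\<^sub>1\<close>, and the latter contribution is
  absorbed by the negative term in \<open>|u\<^sub>k\<^sub>-\<^sub>1|\<^sup>2\<close> of the preceding descent inequality.  In the first
  epoch \<open>m\<^sub>0 = 0\<close>, so \<open>m\<^sub>0\<close> has squared error \<open>|\<nabla>F(w\<^sub>0)|\<^sup>2\<close>; this is why a factor \<open>1 - \<beta>\<close> is lost.

  In turn, \<open>A\<^sub>k\<close> is at most a multiple of \<open>\<eta>\<^sup>2\<close> times the sum of \<open>|m\<^sub>k|\<^sup>2\<close>, \<open>|\<nabla>F(w\<^sub>k)|\<^sup>2\<close> and a shuffling
  error, which depends only on \<open>w\<^sub>k\<close> and on the permutation of the epoch through the partial sums, in shuffled order, of the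
  deviations \<open>\<nabla>f(w\<^sub>k;i) - \<nabla>F(w\<^sub>k)\<close> (lemma \<open>drift_bound\<close>).  Summation over the epochs yields the bound
  \<open>trajectory_bound\<close>, valid for every choice of permutations.

  Randomness enters only through the shuffling error.  For vectors with sum zero, sampling without
  replacement gives distinct positions nonpositive correlation, hence the squared norm of a partial sum
  of \<open>i\<close> shuffled deviations has mean at most \<open>i\<close> times their mean square; since the permutation of an
  epoch is independent of its starting point, the mean shuffling error of an epoch is at most
  \<open>(\<Theta> E|\<nabla>F(w\<^sub>k)|\<^sup>2 + \<sigma>\<^sup>2) / (2 n)\<close>.  This gains the factor \<open>1/n\<close> over an arbitrary order.  The step
  size restriction lets the gradient terms on the right be absorbed on the left.
\<close>

section \<open>Gradients and smoothness\<close>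

lemma grad_eqI:
  fixes f :: "'a::euclidean_space \<Rightarrow> real"
  assumes "GDERIV f w :> g"
  shows "grad f w = g"
  unfolding grad_def
proof (rule the_equality, rule assms)
  fix h assume "GDERIV f w :> h"
  then have "(\<lambda>x. inner x h) = (\<lambda>x. inner x g)"
    using assms unfolding gderiv_def by (rule has_derivative_unique)
  then have "inner x h = inner x g" for x
    by (rule fun_cong)
  then show "h = g"
    by (auto intro: euclidean_eqI simp: inner_commute)
qed

lemma GDERIV_grad:
  fixes f :: "'a::euclidean_space \<Rightarrow> real"
  assumes "f differentiable (at w)"
  shows "GDERIV f w :> grad f w"
proof -
  obtain f' where f': "(f has_derivative f') (at w)"
    using assms by (auto simp: differentiable_def)
  then interpret bounded_linear f'
    by (rule has_derivative_bounded_linear)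
  have "f' x = inner x (\<Sum>b\<in>Basis. f' b *\<^sub>R b)" for x
  proof -
    have "f' x = f' (\<Sum>b\<in>Basis. inner x b *\<^sub>R b)"
      by (simp add: euclidean_representation)
    also have "\<dots> = (\<Sum>b\<in>Basis. inner x b * f' b)"
      by (simp add: sum scaleR)
    finally show ?thesis
      by (simp add: inner_sum_right mult.commute)
  qed
  then have "f' = (\<lambda>x. inner x (\<Sum>b\<in>Basis. f' b *\<^sub>R b))"
    by blast
  then have "GDERIV f w :> (\<Sum>b\<in>Basis. f' b *\<^sub>R b)"
    using f' unfolding gderiv_def by metis
  then show ?thesis
    using grad_eqI by metis
qed

lemma smooth_upper_bound:
  fixes F :: "'a::euclidean_space \<Rightarrow> real"
  assumes deriv: "\<And>w. GDERIV F w :> G w"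
    and lip: "\<And>w w'. norm (G w - G w') \<le> L * norm (w - w')"
  shows "F y \<le> F x + inner (G x) (y - x) + L / 2 * (norm (y - x))\<^sup>2"
proof -
  define \<phi> where
    "\<phi> s = F (x + s *\<^sub>R (y - x)) - s * inner (G x) (y - x) - L / 2 * s\<^sup>2 * (norm (y - x))\<^sup>2" for s
  define \<phi>' where
    "\<phi>' s = inner (y - x) (G (x + s *\<^sub>R (y - x))) - inner (G x) (y - x) - L * s * (norm (y - x))\<^sup>2" for s
  have line: "((\<lambda>s. F (x + s *\<^sub>R (y - x))) has_real_derivative
      inner (y - x) (G (x + s *\<^sub>R (y - x)))) (at s)" for s
  proof -
    have "((\<lambda>s. x + s *\<^sub>R (y - x)) has_derivative (\<lambda>h. h *\<^sub>R (y - x))) (at s)"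
      by (auto intro!: derivative_eq_intros)
    from has_derivative_compose[OF this deriv[unfolded gderiv_def]]
    show ?thesis
      by (simp add: has_field_derivative_def mult_commute_abs)
  qed
  have der: "(\<phi> has_real_derivative \<phi>' s) (at s)" for s
    unfolding \<phi>_def \<phi>'_def
    by (auto intro!: derivative_eq_intros line)
  have neg: "\<phi>' s \<le> 0" if "0 \<le> s" for s
  proof -
    have "inner (y - x) (G (x + s *\<^sub>R (y - x)) - G x)
        \<le> norm (y - x) * norm (G (x + s *\<^sub>R (y - x)) - G x)"
      by (rule norm_cauchy_schwarz)
    also have "\<dots> \<le> norm (y - x) * (L * norm ((x + s *\<^sub>R (y - x)) - x))"
      by (intro mult_left_mono lip) auto
    also have "\<dots> = L * s * (norm (y - x))\<^sup>2"
      using that by (simp add: power2_eq_square)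
    finally show ?thesis
      by (simp add: \<phi>'_def inner_diff_right inner_commute)
  qed
  have "\<phi> 1 \<le> \<phi> 0"
    by (rule DERIV_nonpos_imp_nonincreasing[of 0 1]) (use der neg in auto)
  then show ?thesis
    by (simp add: \<phi>_def)
qed

section \<open>Squared norms of sums\<close>

lemma norm_sum_power2_le:
  fixes x :: "'i \<Rightarrow> 'a::real_normed_vector"
  shows "(norm (sum x A))\<^sup>2 \<le> real (card A) * (\<Sum>i\<in>A. (norm (x i))\<^sup>2)"
proof -
  have "(norm (sum x A))\<^sup>2 \<le> (\<Sum>i\<in>A. norm (x i))\<^sup>2"
    by (intro power_mono norm_sum) auto
  also have "\<dots> \<le> (\<Sum>i\<in>A. (norm (x i))\<^sup>2) * real (card A)"
    by (rule sum_squared_le_sum_of_squares)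
  finally show ?thesis
    by (simp add: mult.commute)
qed

lemma norm_add_power2_le:
  fixes x y :: "'a::real_inner"
  shows "(norm (x + y))\<^sup>2 \<le> 2 * (norm x)\<^sup>2 + 2 * (norm y)\<^sup>2"
proof -
  have "(norm (x + y))\<^sup>2 + (norm (x - y))\<^sup>2 = 2 * (norm x)\<^sup>2 + 2 * (norm y)\<^sup>2"
    by (simp add: power2_norm_eq_inner inner_add_left inner_add_right
        inner_diff_left inner_diff_right inner_commute)
  then show ?thesis
    by (smt (verit) zero_le_power2)
qed

lemma norm_add3_power2_le:
  fixes x y z :: "'a::real_normed_vector"
  shows "(norm (x + y + z))\<^sup>2 \<le> 3 * ((norm x)\<^sup>2 + (norm y)\<^sup>2 + (norm z)\<^sup>2)"
proof -
  have "(norm (x + y + z))\<^sup>2 \<le> (norm x + norm y + norm z)\<^sup>2"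
    by (intro power_mono norm_triangle_le) (auto intro: norm_triangle_ineq)
  also have "3 * ((norm x)\<^sup>2 + (norm y)\<^sup>2 + (norm z)\<^sup>2) - (norm x + norm y + norm z)\<^sup>2
      = (norm x - norm y)\<^sup>2 + (norm y - norm z)\<^sup>2 + (norm x - norm z)\<^sup>2"
    by (simp add: power2_eq_square algebra_simps)
  then have "(norm x + norm y + norm z)\<^sup>2 \<le> 3 * ((norm x)\<^sup>2 + (norm y)\<^sup>2 + (norm z)\<^sup>2)"
    by (smt (verit) zero_le_power2)
  finally show ?thesis .
qed

lemma norm_convex_power2_le:
  fixes x y :: "'a::real_inner"
  assumes "0 \<le> \<beta>" "\<beta> \<le> 1"
  shows "(norm (\<beta> *\<^sub>R x + (1 - \<beta>) *\<^sub>R y))\<^sup>2 \<le> \<beta> * (norm x)\<^sup>2 + (1 - \<beta>) * (norm y)\<^sup>2"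
proof -
  have "\<beta> * (norm x)\<^sup>2 + (1 - \<beta>) * (norm y)\<^sup>2 - (norm (\<beta> *\<^sub>R x + (1 - \<beta>) *\<^sub>R y))\<^sup>2
      = \<beta> * (1 - \<beta>) * (norm (x - y))\<^sup>2"
    by (simp add: power2_norm_eq_inner inner_add_left inner_add_right
        inner_diff_left inner_diff_right inner_commute algebra_simps)
  moreover have "0 \<le> \<beta> * (1 - \<beta>) * (norm (x - y))\<^sup>2"
    using assms by simp
  ultimately show ?thesis
    by linarith
qed

section \<open>Sums over permutations\<close>

lemma sum_permutations_swap:
  assumes "a \<in> S" "b \<in> S"
  shows "(\<Sum>p | p permutes S. h (p \<circ> Transposition.transpose a b)) = (\<Sum>p | p permutes S. h p)"
proof -
  have swap: "q \<circ> Transposition.transpose a b permutes S" if "q permutes S" for q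
    using that assms by (intro permutes_compose permutes_swap_id)
  show ?thesis
    by (rule sum.reindex_bij_witness[where i = "\<lambda>p. p \<circ> Transposition.transpose a b" and j = "\<lambda>p. p \<circ> Transposition.transpose a b"])
       (auto simp: swap comp_assoc)
qed

lemma sum_permutations_at:
  fixes h :: "'i \<Rightarrow> real"
  assumes "finite S" "j \<in> S"
  shows "real (card S) * (\<Sum>p | p permutes S. h (p j)) = fact (card S) * (\<Sum>a\<in>S. h a)"
proof -
  have "(\<Sum>p | p permutes S. h (p k)) = (\<Sum>p | p permutes S. h (p j))" if "k \<in> S" for k
    using sum_permutations_swap[OF \<open>j \<in> S\<close> that, of "\<lambda>p. h (p j)"] by simp
  then have "real (card S) * (\<Sum>p | p permutes S. h (p j))
      = (\<Sum>k\<in>S. \<Sum>p | p permutes S. h (p k))"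
    by simp
  also have "\<dots> = (\<Sum>p | p permutes S. \<Sum>k\<in>S. h (p k))"
    by (rule sum.swap)
  also have "\<dots> = (\<Sum>p | p permutes S. \<Sum>a\<in>S. h a)"
    by (rule sum.cong) (use sum.permute[of _ S h, unfolded comp_def] in simp_all)
  also have "\<dots> = fact (card S) * (\<Sum>a\<in>S. h a)"
    using assms by (simp add: card_permutations)
  finally show ?thesis .
qed

text \<open>
  Sampling without replacement from vectors that sum to zero: the values at two distinct positions
  have nonpositive correlation.
\<close>

lemma sum_permutations_inner_le_0:
  fixes X :: "'i \<Rightarrow> 'a::real_inner"
  assumes "finite S" "j \<in> S" "k \<in> S" "j \<noteq> k" and zero: "sum X S = 0"
  shows "(\<Sum>p | p permutes S. inner (X (p j)) (X (p k))) \<le> 0"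
proof -
  let ?s = "\<lambda>k. \<Sum>p | p permutes S. inner (X (p j)) (X (p k))"
  have eq: "?s l = ?s k" if "l \<in> S - {j}" for l
    using sum_permutations_swap[OF \<open>k \<in> S\<close>, of l "\<lambda>p. inner (X (p j)) (X (p k))"] that \<open>j \<noteq> k\<close>
    by (auto simp: Transposition.transpose_def)
  \<comment> \<open>By symmetry all the terms with \<open>l \<noteq> j\<close> are equal, and all terms together sum to \<open>0\<close>.\<close>
  have "(\<Sum>l\<in>S. ?s l) = (\<Sum>p | p permutes S. inner (X (p j)) (\<Sum>l\<in>S. X (p l)))"
    by (subst sum.swap) (simp add: inner_sum_right)
  also have "\<dots> = 0"
  proof (intro sum.neutral ballI)
    fix p assume "p \<in> {p. p permutes S}"
    then have "(\<Sum>l\<in>S. X (p l)) = sum X S"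
      using sum.permute[of p S X, unfolded comp_def] by simp
    then show "inner (X (p j)) (\<Sum>l\<in>S. X (p l)) = 0"
      using zero by simp
  qed
  finally have "?s j + (\<Sum>l\<in>S - {j}. ?s l) = 0"
    using sum.remove[OF \<open>finite S\<close> \<open>j \<in> S\<close>, of ?s] by simp
  moreover have "0 \<le> ?s j"
    by (intro sum_nonneg) auto
  moreover have "(\<Sum>l\<in>S - {j}. ?s l) = real (card (S - {j})) * ?s k"
    using eq by simp
  ultimately have "real (card (S - {j})) * ?s k \<le> 0"
    by linarith
  moreover have "0 < card (S - {j})"
    using assms by (subst card_gt_0_iff) auto
  ultimately show ?thesis
    by (simp add: mult_le_0_iff)
qed

text \<open>
  Divided by the number of permutations and by the cardinality of \<open>S\<close>, this says that a partial sum
  over \<open>J\<close> has mean squared norm at most \<open>card J\<close> times the mean square of the vectors.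
\<close>

lemma sum_permutations_norm_partial_sum:
  fixes X :: "'i \<Rightarrow> 'a::real_inner"
  assumes "finite S" "J \<subseteq> S" and zero: "sum X S = 0"
  shows "real (card S) * (\<Sum>p | p permutes S. (norm (\<Sum>j\<in>J. X (p j)))\<^sup>2)
    \<le> real (card J) * (fact (card S) * (\<Sum>a\<in>S. (norm (X a))\<^sup>2))"
proof -
  have fin: "finite J"
    using assms finite_subset by blast
  have "(\<Sum>p | p permutes S. (norm (\<Sum>j\<in>J. X (p j)))\<^sup>2)
      = (\<Sum>p | p permutes S. \<Sum>j\<in>J. \<Sum>k\<in>J. inner (X (p j)) (X (p k)))"
    by (simp only: power2_norm_eq_inner inner_sum_left) (simp only: inner_sum_right)
  also have "\<dots> = (\<Sum>j\<in>J. \<Sum>k\<in>J. \<Sum>p | p permutes S. inner (X (p j)) (X (p k)))"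
    by (subst sum.swap, intro sum.cong refl, rule sum.swap)
  also have "\<dots> \<le> (\<Sum>j\<in>J. \<Sum>k\<in>J. if k = j then \<Sum>p | p permutes S. (norm (X (p j)))\<^sup>2 else 0)"
    using assms
    by (intro sum_mono) (auto simp: power2_norm_eq_inner intro!: sum_permutations_inner_le_0)
  also have "\<dots> = (\<Sum>j\<in>J. \<Sum>p | p permutes S. (norm (X (p j)))\<^sup>2)"
    using fin by simp
  finally have "real (card S) * (\<Sum>p | p permutes S. (norm (\<Sum>j\<in>J. X (p j)))\<^sup>2)
      \<le> real (card S) * (\<Sum>j\<in>J. \<Sum>p | p permutes S. (norm (X (p j)))\<^sup>2)"
    by (intro mult_left_mono) auto
  also have "\<dots> = (\<Sum>j\<in>J. real (card S) * (\<Sum>p | p permutes S. (norm (X (p j)))\<^sup>2))"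
    by (simp add: sum_distrib_left)
  also have "\<dots> = (\<Sum>j\<in>J. fact (card S) * (\<Sum>a\<in>S. (norm (X a))\<^sup>2))"
    using assms
    by (intro sum.cong refl sum_permutations_at[where h = "\<lambda>a. (norm (X a))\<^sup>2"]) auto
  finally show ?thesis
    by simp
qed

section \<open>One epoch\<close>

text \<open>
  The inner point reached after \<open>i\<close> steps of an epoch that starts at \<open>w\<close> with momentum \<open>m\<close>.
\<close>

definition smg_point ::
    "nat \<Rightarrow> (nat \<Rightarrow> 'a::euclidean_space \<Rightarrow> real) \<Rightarrow> real \<Rightarrow> real \<Rightarrow> (nat \<Rightarrow> nat)
       \<Rightarrow> 'a \<Rightarrow> 'a \<Rightarrow> nat \<Rightarrow> 'a" where
  "smg_point n f \<beta> \<eta> p w m i = fst (smg_inner n f \<beta> \<eta> p w m i)"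

text \<open>
  The mean squared distance of the points at which an epoch evaluates gradients from its start.
\<close>

definition epoch_drift ::
    "nat \<Rightarrow> (nat \<Rightarrow> 'a::euclidean_space \<Rightarrow> real) \<Rightarrow> real \<Rightarrow> real \<Rightarrow> (nat \<Rightarrow> nat)
       \<Rightarrow> 'a \<Rightarrow> 'a \<Rightarrow> real" where
  "epoch_drift n f \<beta> \<eta> p w m =
     (1 / real n) * (\<Sum>i<n. (norm (smg_point n f \<beta> \<eta> p w m i - w))\<^sup>2)"

text \<open>
  The part of the drift caused by the order of the components, with all gradients taken at the
  starting point \<open>w\<close>.  The normalization by \<open>n\<^sup>3\<close> combines the mean over \<open>i\<close> with the square of the
  factor \<open>1/n\<close> of each inner step.
\<close>

definition shuffle_error ::
    "nat \<Rightarrow> (nat \<Rightarrow> 'a::euclidean_space \<Rightarrow> real) \<Rightarrow> (nat \<Rightarrow> nat) \<Rightarrow> 'a \<Rightarrow> real" where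
  "shuffle_error n f p w =
     (1 / real n ^ 3) * (\<Sum>i<n. (norm (\<Sum>j<i. grad (f (p (Suc j))) w - grad (avg_fun n f) w))\<^sup>2)"

lemma smg_inner_unfold:
  shows "smg_point n f \<beta> \<eta> p w m i
      = w - (\<eta> / real n) *\<^sub>R (\<Sum>j<i. \<beta> *\<^sub>R m
          + (1 - \<beta>) *\<^sub>R grad (f (p (Suc j))) (smg_point n f \<beta> \<eta> p w m j))"
    and "snd (snd (smg_inner n f \<beta> \<eta> p w m i))
      = (1 / real n) *\<^sub>R (\<Sum>j<i. grad (f (p (Suc j))) (smg_point n f \<beta> \<eta> p w m j))"
proof (induction i)
  case 0
  show "smg_point n f \<beta> \<eta> p w m 0
      = w - (\<eta> / real n) *\<^sub>R (\<Sum>j<0. \<beta> *\<^sub>R m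
          + (1 - \<beta>) *\<^sub>R grad (f (p (Suc j))) (smg_point n f \<beta> \<eta> p w m j))"
    and "snd (snd (smg_inner n f \<beta> \<eta> p w m 0))
      = (1 / real n) *\<^sub>R (\<Sum>j<0. grad (f (p (Suc j))) (smg_point n f \<beta> \<eta> p w m j))"
    by (simp_all add: smg_point_def)
next
  case (Suc i)
  have "smg_point n f \<beta> \<eta> p w m (Suc i) = smg_point n f \<beta> \<eta> p w m i
      - (\<eta> / real n) *\<^sub>R (\<beta> *\<^sub>R m
          + (1 - \<beta>) *\<^sub>R grad (f (p (Suc i))) (smg_point n f \<beta> \<eta> p w m i))"
    and "snd (snd (smg_inner n f \<beta> \<eta> p w m (Suc i))) = snd (snd (smg_inner n f \<beta> \<eta> p w m i))
      + (1 / real n) *\<^sub>R grad (f (p (Suc i))) (smg_point n f \<beta> \<eta> p w m i)"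
    by (simp_all add: smg_point_def Let_def case_prod_beta)
  note step = this
  show "smg_point n f \<beta> \<eta> p w m (Suc i)
      = w - (\<eta> / real n) *\<^sub>R (\<Sum>j<Suc i. \<beta> *\<^sub>R m
          + (1 - \<beta>) *\<^sub>R grad (f (p (Suc j))) (smg_point n f \<beta> \<eta> p w m j))"
    unfolding step(1) using Suc(1) by (simp add: scaleR_add_right)
  show "snd (snd (smg_inner n f \<beta> \<eta> p w m (Suc i)))
      = (1 / real n) *\<^sub>R (\<Sum>j<Suc i. grad (f (p (Suc j))) (smg_point n f \<beta> \<eta> p w m j))"
    unfolding step(2) using Suc(2) by (simp add: scaleR_add_right)
qed

text \<open>
  A fixed problem and a fixed step size.  The condition \<open>30 (L \<eta>)\<^sup>2 \<le> 1\<close> is what the requirement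
  \<open>\<eta> \<le> 1 / (L \<surd>D)\<close> implies irrespective of \<open>n\<close>, \<open>\<beta>\<close> and \<open>\<Theta>\<close>.
\<close>

locale smg =
  fixes n :: nat and f :: "nat \<Rightarrow> 'a::euclidean_space \<Rightarrow> real" and L \<Theta> \<sigma> \<beta> \<eta> :: real
  assumes problem: "smg_problem n f L \<Theta> \<sigma>"
    and \<beta>_nonneg: "0 \<le> \<beta>" and \<beta>_less: "\<beta> < 1" and \<eta>_pos: "0 < \<eta>"
    and step_small: "30 * (L * \<eta>)\<^sup>2 \<le> 1"
begin

abbreviation "F \<equiv> avg_fun n f"
abbreviation "gradF \<equiv> grad (avg_fun n f)"
abbreviation "drift \<equiv> epoch_drift n f \<beta> \<eta>"
abbreviation "err \<equiv> shuffle_error n f"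

lemma n_pos: "0 < n" "1 \<le> real n"
  using problem by (auto simp: smg_problem_def)

lemma component_Lipschitz:
  "i \<in> {1..n} \<Longrightarrow> norm (grad (f i) w - grad (f i) w') \<le> L * norm (w - w')"
  using problem by (auto simp: smg_problem_def)

lemma GDERIV_average: "GDERIV F w :> (1 / real n) *\<^sub>R (\<Sum>i = 1..n. grad (f i) w)"
proof -
  have "((\<lambda>w. \<Sum>i = 1..n. f i w) has_derivative (\<lambda>h. \<Sum>i = 1..n. inner h (grad (f i) w))) (at w)"
    using problem
    by (intro has_derivative_sum GDERIV_grad[unfolded gderiv_def]) (auto simp: smg_problem_def)
  then have "((\<lambda>w. (1 / real n) * (\<Sum>i = 1..n. f i w)) has_derivative
      (\<lambda>h. (1 / real n) * (\<Sum>i = 1..n. inner h (grad (f i) w)))) (at w)"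
    by (rule has_derivative_mult_right)
  then show ?thesis
    by (simp add: gderiv_def avg_fun_def[abs_def] inner_sum_right)
qed

lemma grad_average: "gradF w = (1 / real n) *\<^sub>R (\<Sum>i = 1..n. grad (f i) w)"
  by (rule grad_eqI[OF GDERIV_average])

lemma deviations_sum_zero: "(\<Sum>i = 1..n. grad (f i) w - gradF w) = 0"
  using n_pos by (simp add: sum_subtractf grad_average sum_constant_scaleR)

lemma grad_average_Lipschitz: "norm (gradF w - gradF w') \<le> L * norm (w - w')"
proof -
  have "norm (gradF w - gradF w') = (1 / real n) * norm (\<Sum>i = 1..n. grad (f i) w - grad (f i) w')"
    by (simp add: grad_average sum_subtractf flip: scaleR_diff_right)
  also have "\<dots> \<le> (1 / real n) * (\<Sum>i = 1..n. L * norm (w - w'))"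
    by (intro mult_left_mono sum_norm_le component_Lipschitz) auto
  also have "\<dots> = L * norm (w - w')"
    using n_pos by simp
  finally show ?thesis .
qed

lemma average_upper_bound:
  "F y \<le> F x + inner (gradF x) (y - x) + L / 2 * (norm (y - x))\<^sup>2"
  by (rule smooth_upper_bound[OF _ grad_average_Lipschitz])
     (unfold grad_average, rule GDERIV_average)

lemma average_lower_bound: "inf_val n f \<le> F w"
  unfolding inf_val_def using problem by (auto simp: smg_problem_def intro: cINF_lower)

lemma drift_nonneg: "0 \<le> drift p w m"
  by (simp add: epoch_drift_def sum_nonneg)

lemma shuffle_error_nonneg: "0 \<le> err p w"
  by (simp add: shuffle_error_def sum_nonneg)

lemma permuted_grad_average:
  assumes "p permutes {1..n}"
  shows "gradF w = (1 / real n) *\<^sub>R (\<Sum>j<n. grad (f (p (Suc j))) w)"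
proof -
  have "(\<Sum>j<n. grad (f (p (Suc j))) w) = (\<Sum>i = 1..n. grad (f (p i)) w)"
    by (rule sum.reindex_bij_witness[where i = "\<lambda>i. i - 1" and j = Suc]) auto
  also have "\<dots> = (\<Sum>i = 1..n. grad (f i) w)"
    using sum.permute[OF assms, of "\<lambda>i. grad (f i) w"] by (simp add: comp_def)
  finally show ?thesis
    by (simp add: grad_average)
qed

lemma permuted_index: "p permutes {1..n} \<Longrightarrow> j < n \<Longrightarrow> p (Suc j) \<in> {1..n}"
  by (simp add: permutes_in_image del: atLeastAtMost_iff) simp

lemma drift_sum: "(\<Sum>i<n. (norm (smg_point n f \<beta> \<eta> p w m i - w))\<^sup>2) = real n * drift p w m"
  using n_pos by (simp add: epoch_drift_def)

lemma partial_gradient_error: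
  assumes p: "p permutes {1..n}" and i: "i \<le> n"
  shows "(norm (\<Sum>j<i. grad (f (p (Suc j))) (smg_point n f \<beta> \<eta> p w m j) - grad (f (p (Suc j))) w))\<^sup>2
    \<le> real i * (L\<^sup>2 * (real n * drift p w m))"
proof -
  let ?x = "smg_point n f \<beta> \<eta> p w m"
  have "(norm (\<Sum>j<i. grad (f (p (Suc j))) (?x j) - grad (f (p (Suc j))) w))\<^sup>2
      \<le> real i * (\<Sum>j<i. (norm (grad (f (p (Suc j))) (?x j) - grad (f (p (Suc j))) w))\<^sup>2)"
    using norm_sum_power2_le[of _ "{..<i}"] by simp
  also have "\<dots> \<le> real i * (\<Sum>j<i. (L * norm (?x j - w))\<^sup>2)"
    using permuted_index[OF p] i
    by (intro mult_left_mono sum_mono power_mono component_Lipschitz) auto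
  also have "\<dots> \<le> real i * (\<Sum>j<n. (L * norm (?x j - w))\<^sup>2)"
    using i by (intro mult_left_mono sum_mono2) auto
  also have "\<dots> = real i * (L\<^sup>2 * (real n * drift p w m))"
    by (simp add: power_mult_distrib drift_sum flip: sum_distrib_left)
  finally show ?thesis .
qed

lemma epoch_momentum_error:
  assumes p: "p permutes {1..n}"
  shows "(norm (snd (snd (smg_inner n f \<beta> \<eta> p w m n)) - gradF w))\<^sup>2 \<le> L\<^sup>2 * drift p w m"
proof -
  have "(norm (snd (snd (smg_inner n f \<beta> \<eta> p w m n)) - gradF w))\<^sup>2
     = (1 / real n)\<^sup>2 * (norm (\<Sum>j<n. grad (f (p (Suc j))) (smg_point n f \<beta> \<eta> p w m j) - grad (f (p (Suc j))) w))\<^sup>2"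
    by (simp add: smg_inner_unfold(2) permuted_grad_average[OF p] sum_subtractf power_divide
        flip: scaleR_diff_right)
  also have "\<dots> \<le> (1 / real n)\<^sup>2 * (real n * (L\<^sup>2 * (real n * drift p w m)))"
    by (intro mult_left_mono partial_gradient_error p) auto
  also have "\<dots> = L\<^sup>2 * drift p w m"
    using n_pos by (simp add: power2_eq_square)
  finally show ?thesis .
qed

lemma epoch_step:
  "fst (smg_inner n f \<beta> \<eta> p w m n)
    = w - \<eta> *\<^sub>R (\<beta> *\<^sub>R m + (1 - \<beta>) *\<^sub>R snd (snd (smg_inner n f \<beta> \<eta> p w m n)))"
proof -
  have "fst (smg_inner n f \<beta> \<eta> p w m n) = smg_point n f \<beta> \<eta> p w m n"
    by (simp add: smg_point_def)
  also have "\<dots> = w - (\<eta> / real n) *\<^sub>R (real n *\<^sub>R (\<beta> *\<^sub>R m)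
      + (1 - \<beta>) *\<^sub>R (\<Sum>j<n. grad (f (p (Suc j))) (smg_point n f \<beta> \<eta> p w m j)))"
    by (subst smg_inner_unfold(1)) (simp add: sum.distrib sum_constant_scaleR flip: scaleR_sum_right)
  finally show ?thesis
    using n_pos by (simp add: smg_inner_unfold(2) scaleR_add_right)
qed

lemma sum_indices: "(\<Sum>i<n. real i) \<le> real n ^ 2 / 2" "(\<Sum>i<n. (real i)\<^sup>2) \<le> real n ^ 3 / 3"
proof -
  have "(\<Sum>i<k. real i) \<le> real k ^ 2 / 2" for k
    by (induction k) (auto simp: power2_eq_square field_simps)
  moreover have "(\<Sum>i<k. (real i)\<^sup>2) \<le> real k ^ 3 / 3" for k
    by (induction k) (auto simp: power2_eq_square power3_eq_cube field_simps)
  ultimately show "(\<Sum>i<n. real i) \<le> real n ^ 2 / 2" "(\<Sum>i<n. (real i)\<^sup>2) \<le> real n ^ 3 / 3"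
    by blast+
qed

text \<open>
  The momentum part, the gradient part and the shuffling part of the drift are separated; the error of
  evaluating gradients at the moving inner points is a multiple of the drift itself and moves to the
  left-hand side.
\<close>

lemma drift_bound:
  assumes p: "p permutes {1..n}"
  shows "(1 - 3 / 2 * (L * \<eta>)\<^sup>2) * drift p w m
    \<le> \<eta>\<^sup>2 * (\<beta> / 3 * (norm m)\<^sup>2 + (1 - \<beta>) * ((norm (gradF w))\<^sup>2 + 3 * err p w))"
proof -
  define x where "x = smg_point n f \<beta> \<eta> p w m"
  define g where "g j = grad (f (p (Suc j))) (x j)" for j
  define h where "h j = grad (f (p (Suc j))) w" for j
  define E where "E i = (norm (\<Sum>j<i. h j - gradF w))\<^sup>2" for i
  define a where "a = drift p w m"
  define G where "G = (norm (gradF w))\<^sup>2"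
  have grads: "(norm (\<Sum>j<i. g j))\<^sup>2 \<le> 3 * (real i * (L\<^sup>2 * (real n * a)) + E i + (real i)\<^sup>2 * G)"
    if "i \<le> n" for i
  proof -
    have "(\<Sum>j<i. g j) = (\<Sum>j<i. g j - h j) + (\<Sum>j<i. h j - gradF w) + real i *\<^sub>R gradF w"
      by (simp add: sum_subtractf sum_constant_scaleR)
    then have "(norm (\<Sum>j<i. g j))\<^sup>2
        \<le> 3 * ((norm (\<Sum>j<i. g j - h j))\<^sup>2 + E i + (norm (real i *\<^sub>R gradF w))\<^sup>2)"
      by (simp only: E_def norm_add3_power2_le)
    moreover have "(norm (\<Sum>j<i. g j - h j))\<^sup>2 \<le> real i * (L\<^sup>2 * (real n * a))"
      using partial_gradient_error[OF p that] by (simp add: g_def h_def x_def a_def)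
    ultimately show ?thesis
      by (simp add: power_mult_distrib G_def)
  qed
  have pointwise: "(norm (x i - w))\<^sup>2 \<le> (\<eta> / real n)\<^sup>2 * (\<beta> * (norm m)\<^sup>2 * (real i)\<^sup>2
      + 3 * (1 - \<beta>) * (L\<^sup>2 * real n * a * real i + E i + G * (real i)\<^sup>2))" if "i < n" for i
  proof -
    have "x i - w = - ((\<eta> / real n) *\<^sub>R (\<beta> *\<^sub>R (real i *\<^sub>R m) + (1 - \<beta>) *\<^sub>R (\<Sum>j<i. g j)))"
      unfolding x_def g_def
      by (subst smg_inner_unfold(1))
         (simp add: sum.distrib sum_constant_scaleR mult.commute flip: scaleR_sum_right)
    then have "(norm (x i - w))\<^sup>2
        = (\<eta> / real n)\<^sup>2 * (norm (\<beta> *\<^sub>R (real i *\<^sub>R m) + (1 - \<beta>) *\<^sub>R (\<Sum>j<i. g j)))\<^sup>2"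
      by (simp only: norm_minus_cancel norm_scaleR power_mult_distrib power2_abs)
    also have "\<dots> \<le> (\<eta> / real n)\<^sup>2
        * (\<beta> * (norm (real i *\<^sub>R m))\<^sup>2 + (1 - \<beta>) * (norm (\<Sum>j<i. g j))\<^sup>2)"
      using \<beta>_nonneg \<beta>_less by (intro mult_left_mono norm_convex_power2_le) auto
    also have "\<dots> \<le> (\<eta> / real n)\<^sup>2 * (\<beta> * (norm (real i *\<^sub>R m))\<^sup>2
        + (1 - \<beta>) * (3 * (real i * (L\<^sup>2 * (real n * a)) + E i + (real i)\<^sup>2 * G)))"
      using \<beta>_nonneg \<beta>_less grads[of i] that
      by (intro mult_left_mono add_left_mono) auto
    finally show ?thesis
      by (simp add: power_mult_distrib algebra_simps)
  qed
  have "real n * a = (\<Sum>i<n. (norm (x i - w))\<^sup>2)"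
    by (simp add: a_def x_def drift_sum)
  also have "\<dots> \<le> (\<Sum>i<n. (\<eta> / real n)\<^sup>2 * (\<beta> * (norm m)\<^sup>2 * (real i)\<^sup>2
      + 3 * (1 - \<beta>) * (L\<^sup>2 * real n * a * real i + E i + G * (real i)\<^sup>2)))"
    by (intro sum_mono pointwise) auto
  also have "\<dots> = (\<eta> / real n)\<^sup>2 * (\<beta> * (norm m)\<^sup>2 * (\<Sum>i<n. (real i)\<^sup>2)
      + 3 * (1 - \<beta>) * (L\<^sup>2 * real n * a * (\<Sum>i<n. real i) + (\<Sum>i<n. E i) + G * (\<Sum>i<n. (real i)\<^sup>2)))"
    by (simp only: sum.distrib flip: sum_distrib_left)
  also have "\<dots> \<le> (\<eta> / real n)\<^sup>2 * (\<beta> * (norm m)\<^sup>2 * (real n ^ 3 / 3)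
      + 3 * (1 - \<beta>) * (L\<^sup>2 * real n * a * (real n ^ 2 / 2) + real n ^ 3 * err p w + G * (real n ^ 3 / 3)))"
  proof -
    have "(\<Sum>i<n. E i) = real n ^ 3 * err p w"
      using n_pos by (simp add: shuffle_error_def E_def h_def)
    moreover have "0 \<le> a" "0 \<le> G"
      by (simp_all add: a_def drift_nonneg G_def)
    ultimately show ?thesis
      using \<beta>_nonneg \<beta>_less sum_indices
      by (intro mult_left_mono add_mono) auto
  qed
  also have "\<dots> = real n * (\<eta>\<^sup>2 * (\<beta> / 3 * (norm m)\<^sup>2
      + (1 - \<beta>) * (3 / 2 * L\<^sup>2 * a + 3 * err p w + G)))"
    using n_pos by (simp add: field_simps power2_eq_square power3_eq_cube)
  finally have "a \<le> \<eta>\<^sup>2 * (\<beta> / 3 * (norm m)\<^sup>2 + (1 - \<beta>) * (3 / 2 * L\<^sup>2 * a + 3 * err p w + G))"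
    using n_pos by simp
  also have "\<dots> = \<eta>\<^sup>2 * (\<beta> / 3 * (norm m)\<^sup>2 + (1 - \<beta>) * (G + 3 * err p w))
      + (1 - \<beta>) * (3 / 2 * (L * \<eta>)\<^sup>2 * a)"
    by (simp add: algebra_simps power_mult_distrib)
  also have "(1 - \<beta>) * (3 / 2 * (L * \<eta>)\<^sup>2 * a) \<le> 1 * (3 / 2 * (L * \<eta>)\<^sup>2 * a)"
    using \<beta>_nonneg by (intro mult_right_mono) (auto simp: a_def drift_nonneg)
  finally show ?thesis
    unfolding a_def G_def by (simp add: algebra_simps)
qed

end

section \<open>Random reshuffling\<close>

lemma expectation_pair_pmf_finite:
  fixes h :: "'b \<times> 'c \<Rightarrow> real"
  assumes "finite (set_pmf p)" "finite (set_pmf q)"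
  shows "measure_pmf.expectation (pair_pmf p q) h
    = measure_pmf.expectation q (\<lambda>y. measure_pmf.expectation p (\<lambda>x. h (x, y)))"
proof -
  have "measure_pmf.expectation (pair_pmf p q) h
      = (\<Sum>z\<in>set_pmf p \<times> set_pmf q. h z * pmf (pair_pmf p q) z)"
    using assms by (intro integral_measure_pmf_real) auto
  also have "\<dots> = (\<Sum>x\<in>set_pmf p. \<Sum>y\<in>set_pmf q. h (x, y) * (pmf p x * pmf q y))"
    by (simp add: sum.cartesian_product) (intro sum.cong, auto simp: pmf_pair)
  also have "\<dots> = (\<Sum>y\<in>set_pmf q. (\<Sum>x\<in>set_pmf p. h (x, y) * pmf p x) * pmf q y)"
    by (subst sum.swap) (simp add: sum_distrib_right mult.assoc)
  also have "\<dots> = (\<Sum>y\<in>set_pmf q. measure_pmf.expectation p (\<lambda>x. h (x, y)) * pmf q y)"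
    using assms by (simp add: integral_measure_pmf_real[where A = "set_pmf p"])
  also have "\<dots> = measure_pmf.expectation q (\<lambda>y. measure_pmf.expectation p (\<lambda>x. h (x, y)))"
    using assms by (subst integral_measure_pmf_real[where A = "set_pmf q"]) auto
  finally show ?thesis .
qed

lemma set_pmf_permutations:
  "set_pmf (pmf_of_set {p. p permutes {1..n::nat}}) = {p. p permutes {1..n}}"
  by (rule set_pmf_of_set) (auto simp: finite_permutations intro: permutes_id)

lemma set_Pi_pmf_permutations:
  "finite A \<Longrightarrow> set_pmf (Pi_pmf A id (\<lambda>_. pmf_of_set {p. p permutes {1..n::nat}}))
    = PiE_dflt A id (\<lambda>_. {p. p permutes {1..n}})"
  by (subst set_Pi_pmf) (simp_all only: set_pmf_permutations comp_def)

lemma finite_set_Pi_pmf_permutations: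
  "finite A \<Longrightarrow> finite (set_pmf (Pi_pmf A id (\<lambda>_. pmf_of_set {p. p permutes {1..n::nat}})))"
  by (simp only: set_Pi_pmf_permutations) (intro finite_PiE_dflt, simp_all add: finite_permutations)

lemma finite_set_rr_perms: "finite (set_pmf (rr_perms n T))"
  unfolding rr_perms_def by (rule finite_set_Pi_pmf_permutations) simp

lemma rr_perms_permutes: "\<pi> \<in> set_pmf (rr_perms n T) \<Longrightarrow> t \<in> {1..T} \<Longrightarrow> \<pi> t permutes {1..n}"
  unfolding rr_perms_def by (subst (asm) set_Pi_pmf_permutations) (auto simp: PiE_dflt_def)

text \<open>
  The permutation of epoch \<open>t\<close> is independent of those of all other epochs.
\<close>

lemma rr_perms_split:
  assumes "t \<in> {1..T}"
  shows "rr_perms n T = map_pmf (\<lambda>(p, \<pi>). \<pi>(t := p))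
    (pair_pmf (pmf_of_set {p. p permutes {1..n}})
      (Pi_pmf ({1..T} - {t}) id (\<lambda>_. pmf_of_set {p. p permutes {1..n}})))"
proof -
  have "insert t ({1..T} - {t}) = {1..T}"
    using assms by blast
  then show ?thesis
    unfolding rr_perms_def
    using Pi_pmf_insert[of "{1..T} - {t}" t id "\<lambda>_. pmf_of_set {p. p permutes {1..n}}"]
    by (simp del: insert_Diff_single)
qed

text \<open>
  The state after \<open>k\<close> epochs depends only on the first \<open>k\<close> permutations.
\<close>

lemma smg_outer_cong:
  "(\<And>t. t \<in> {1..k} \<Longrightarrow> \<pi> t = \<pi>' t) \<Longrightarrow> smg_outer n f \<beta> \<eta> \<pi> w0 k = smg_outer n f \<beta> \<eta> \<pi>' w0 k"
proof (induction k)
  case (Suc k)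
  have "smg_outer n f \<beta> \<eta> \<pi> w0 k = smg_outer n f \<beta> \<eta> \<pi>' w0 k"
    using Suc.prems by (intro Suc.IH) simp
  moreover have "\<pi> (k + 1) = \<pi>' (k + 1)"
    using Suc.prems by simp
  ultimately show ?case
    by (simp only: smg_outer.simps)
qed simp

section \<open>Descent along a trajectory\<close>

context smg
begin

abbreviation "iter \<equiv> smg_iterate n f \<beta> (\<lambda>_. \<eta>)"
abbreviation "mom \<pi> w0 t \<equiv> snd (smg_outer n f \<beta> (\<lambda>_. \<eta>) \<pi> w0 t)"

lemma iter_Suc:
  "iter \<pi> w0 (Suc k) = fst (smg_inner n f \<beta> \<eta> (\<pi> (Suc k)) (iter \<pi> w0 k) (mom \<pi> w0 k) n)"
  "mom \<pi> w0 (Suc k) = snd (snd (smg_inner n f \<beta> \<eta> (\<pi> (Suc k)) (iter \<pi> w0 k) (mom \<pi> w0 k) n))"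
  by (simp_all add: smg_iterate_def Let_def case_prod_beta)

lemma step_le: "L * \<eta> \<le> 1 / 5"
proof (rule power2_le_imp_le)
  show "(L * \<eta>)\<^sup>2 \<le> (1 / 5)\<^sup>2"
    using step_small by (simp add: power_divide)
qed simp

lemma epoch_descent:
  fixes p w m
  defines "m' \<equiv> snd (snd (smg_inner n f \<beta> \<eta> p w m n))"
  assumes p: "p permutes {1..n}"
  shows "F (fst (smg_inner n f \<beta> \<eta> p w m n)) \<le> F w - \<eta> / 2 * ((norm (gradF w))\<^sup>2
      - \<beta> * (norm (gradF w - m))\<^sup>2 - (1 - \<beta>) * (L\<^sup>2 * drift p w m)
      + (1 - L * \<eta>) * (norm (\<beta> *\<^sub>R m + (1 - \<beta>) *\<^sub>R m'))\<^sup>2)"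
proof -
  define u where "u = \<beta> *\<^sub>R m + (1 - \<beta>) *\<^sub>R m'"
  have "(norm (gradF w - u))\<^sup>2 = (norm (\<beta> *\<^sub>R (gradF w - m) + (1 - \<beta>) *\<^sub>R (gradF w - m')))\<^sup>2"
    by (simp add: u_def algebra_simps)
  also have "\<dots> \<le> \<beta> * (norm (gradF w - m))\<^sup>2 + (1 - \<beta>) * (norm (gradF w - m'))\<^sup>2"
    using \<beta>_nonneg \<beta>_less by (intro norm_convex_power2_le) auto
  also have "\<dots> \<le> \<beta> * (norm (gradF w - m))\<^sup>2 + (1 - \<beta>) * (L\<^sup>2 * drift p w m)"
    using \<beta>_less epoch_momentum_error[OF p, of w m]
    by (intro add_left_mono mult_left_mono) (auto simp: m'_def norm_minus_commute)
  finally have dev: "(norm (gradF w - u))\<^sup>2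
      \<le> \<beta> * (norm (gradF w - m))\<^sup>2 + (1 - \<beta>) * (L\<^sup>2 * drift p w m)" .
  have "F (w - \<eta> *\<^sub>R u) \<le> F w - \<eta> * inner (gradF w) u + L / 2 * (\<eta>\<^sup>2 * (norm u)\<^sup>2)"
    using average_upper_bound[of "w - \<eta> *\<^sub>R u" w] by (simp add: power_mult_distrib)
  also have "\<dots> = F w - \<eta> / 2 * ((norm (gradF w))\<^sup>2 - (norm (gradF w - u))\<^sup>2 + (1 - L * \<eta>) * (norm u)\<^sup>2)"
    by (simp add: power2_norm_eq_inner inner_diff_left inner_diff_right inner_commute)
       (simp add: field_simps power2_eq_square)
  also have "\<dots> \<le> F w - \<eta> / 2 * ((norm (gradF w))\<^sup>2
      - (\<beta> * (norm (gradF w - m))\<^sup>2 + (1 - \<beta>) * (L\<^sup>2 * drift p w m)) + (1 - L * \<eta>) * (norm u)\<^sup>2)"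
    using dev \<eta>_pos by (intro diff_left_mono mult_left_mono add_right_mono) auto
  finally show ?thesis
    by (simp add: epoch_step u_def m'_def diff_diff_add)
qed

text \<open>
  The error of the new momentum as an estimate of the gradient at the new iterate, where the next
  epoch starts.
\<close>

lemma next_momentum_error:
  fixes p w m
  defines "m' \<equiv> snd (snd (smg_inner n f \<beta> \<eta> p w m n))"
  assumes p: "p permutes {1..n}"
  shows "(norm (gradF (fst (smg_inner n f \<beta> \<eta> p w m n)) - m'))\<^sup>2
    \<le> 2 * (L * \<eta>)\<^sup>2 * (norm (\<beta> *\<^sub>R m + (1 - \<beta>) *\<^sub>R m'))\<^sup>2 + 2 * L\<^sup>2 * drift p w m"
proof -
  define u where "u = \<beta> *\<^sub>R m + (1 - \<beta>) *\<^sub>R m'"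
  have w': "fst (smg_inner n f \<beta> \<eta> p w m n) = w - \<eta> *\<^sub>R u"
    by (simp add: epoch_step u_def m'_def)
  have "norm (gradF (w - \<eta> *\<^sub>R u) - gradF w) \<le> L * norm (\<eta> *\<^sub>R u)"
    using grad_average_Lipschitz[of "w - \<eta> *\<^sub>R u" w] by simp
  then have "(norm (gradF (w - \<eta> *\<^sub>R u) - gradF w))\<^sup>2 \<le> (L * norm (\<eta> *\<^sub>R u))\<^sup>2"
    by (intro power_mono) auto
  moreover have "(norm (gradF w - m'))\<^sup>2 \<le> L\<^sup>2 * drift p w m"
    using epoch_momentum_error[OF p, of w m] by (simp add: m'_def norm_minus_commute)
  moreover have "(norm (gradF (w - \<eta> *\<^sub>R u) - m'))\<^sup>2
      \<le> 2 * (norm (gradF (w - \<eta> *\<^sub>R u) - gradF w))\<^sup>2 + 2 * (norm (gradF w - m'))\<^sup>2"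
    using norm_add_power2_le[of "gradF (w - \<eta> *\<^sub>R u) - gradF w" "gradF w - m'"] by simp
  ultimately have "(norm (gradF (w - \<eta> *\<^sub>R u) - m'))\<^sup>2
      \<le> 2 * (L * norm (\<eta> *\<^sub>R u))\<^sup>2 + 2 * (L\<^sup>2 * drift p w m)"
    by linarith
  then show ?thesis
    unfolding w' u_def[symmetric] by (simp add: power_mult_distrib)
qed

lemma next_momentum_norm:
  assumes p: "p permutes {1..n}"
  shows "(norm (snd (snd (smg_inner n f \<beta> \<eta> p w m n))))\<^sup>2
    \<le> 2 * (norm (gradF w))\<^sup>2 + 2 * L\<^sup>2 * drift p w m"
  using norm_add_power2_le[of "gradF w" "snd (snd (smg_inner n f \<beta> \<eta> p w m n)) - gradF w"]
    epoch_momentum_error[OF p, of w m] by simp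

text \<open>
  This holds for every sequence of permutations.  The coefficients are not optimized:
  \<open>30 (L \<eta>)\<^sup>2 \<le> 1\<close> leaves room.
\<close>

lemma trajectory_bound:
  assumes perm: "\<And>t. t \<in> {1..T} \<Longrightarrow> \<pi> t permutes {1..n}" and T: "1 \<le> T"
  shows "(1 - \<beta>) * (\<Sum>k<T. (norm (gradF (iter \<pi> w0 k)))\<^sup>2)
    \<le> 2 * (F w0 - inf_val n f) / \<eta>
      + 8 / 3 * (L * \<eta>)\<^sup>2 * ((\<Sum>k<T. (norm (gradF (iter \<pi> w0 k)))\<^sup>2)
          + 3 * (\<Sum>k<T. err (\<pi> (Suc k)) (iter \<pi> w0 k)))"
proof -
  define w m where "w = iter \<pi> w0" and "m = mom \<pi> w0"
  define a where "a k = drift (\<pi> (Suc k)) (w k) (m k)" for k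
  define G where "G k = (norm (gradF (w k)))\<^sup>2" for k
  define U where "U k = (norm (\<beta> *\<^sub>R m k + (1 - \<beta>) *\<^sub>R m (Suc k)))\<^sup>2" for k
  define e where "e k = (norm (gradF (w k) - m k))\<^sup>2" for k
  define R where "R k = err (\<pi> (Suc k)) (w k)" for k
  define S A V E Q M where "S = sum G {..<T}" and "A = sum a {..<T}" and "V = sum U {..<T}"
    and "E = sum e {..<T}" and "Q = sum R {..<T}" and "M = (\<Sum>k<T. (norm (m k))\<^sup>2)"
  have p: "\<pi> (Suc k) permutes {1..n}" if "k < T" for k
    using perm that by simp
  have w_Suc: "w (Suc k) = fst (smg_inner n f \<beta> \<eta> (\<pi> (Suc k)) (w k) (m k) n)"
    and m_Suc: "m (Suc k) = snd (snd (smg_inner n f \<beta> \<eta> (\<pi> (Suc k)) (w k) (m k) n))" for k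
    by (simp_all add: w_def m_def iter_Suc del: smg_outer.simps)
  have start: "w 0 = w0" "m 0 = 0"
    by (simp_all add: w_def m_def smg_iterate_def)
  have a_nonneg: "0 \<le> a k" and G_nonneg: "0 \<le> G k" and U_nonneg: "0 \<le> U k"
    and R_nonneg: "0 \<le> R k" for k
    by (simp_all add: a_def G_def U_def R_def drift_nonneg shuffle_error_nonneg)
  obtain T' where T': "T = Suc T'"
    using T by (cases T) auto
  have A_nonneg: "0 \<le> A" and V_nonneg: "0 \<le> V" and S_nonneg: "0 \<le> S" and Q_nonneg: "0 \<le> Q"
    unfolding A_def V_def S_def Q_def by (auto intro!: sum_nonneg a_nonneg U_nonneg G_nonneg R_nonneg)
  define q where "q = (L * \<eta>)\<^sup>2"
  have q: "0 \<le> q" "30 * q \<le> 1"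
    using step_small by (simp_all add: q_def)

  \<comment> \<open>Sum the descent inequality over all epochs.\<close>
  have descent: "F (w (Suc k)) - F (w k)
      \<le> - (\<eta> / 2) * (G k - \<beta> * e k - (1 - \<beta>) * L\<^sup>2 * a k + (1 - L * \<eta>) * U k)" if "k < T" for k
    using epoch_descent[OF p[OF that], of "w k" "m k"]
    by (simp add: G_def e_def U_def a_def mult.assoc flip: w_Suc m_Suc)
  have "inf_val n f - F w0 \<le> F (w T) - F (w 0)"
    using average_lower_bound[of "w T"] by (simp add: start)
  also have "\<dots> = (\<Sum>k<T. F (w (Suc k)) - F (w k))"
    by (rule sum_lessThan_telescope[symmetric])
  also have "\<dots> \<le> (\<Sum>k<T. - (\<eta> / 2) * (G k - \<beta> * e k - (1 - \<beta>) * L\<^sup>2 * a k + (1 - L * \<eta>) * U k))"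
    using descent by (intro sum_mono) auto
  also have "\<dots> = - (\<eta> / 2) * (S - \<beta> * E - (1 - \<beta>) * L\<^sup>2 * A + (1 - L * \<eta>) * V)"
    unfolding S_def E_def A_def V_def
    by (simp only: sum_distrib_left[symmetric] sum.distrib sum_subtractf)
  finally have "S - \<beta> * E - (1 - \<beta>) * L\<^sup>2 * A + (1 - L * \<eta>) * V \<le> 2 * (F w0 - inf_val n f) / \<eta>"
    using \<eta>_pos by (simp add: field_simps)
  \<comment> \<open>As \<open>m 0 = 0\<close>, the first epoch contributes the full \<open>G 0\<close>, which is bounded by \<open>S\<close>.\<close>
  moreover have "\<beta> * E \<le> \<beta> * (S + (2 * q * V + 2 * L\<^sup>2 * A))"
  proof (intro mult_left_mono \<beta>_nonneg)
    have "E = G 0 + (\<Sum>k<T'. e (Suc k))"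
      unfolding E_def T' by (simp add: sum.lessThan_Suc_shift e_def G_def start del: sum.lessThan_Suc)
    also have "\<dots> \<le> G 0 + (\<Sum>k<T'. 2 * q * U k + 2 * L\<^sup>2 * a k)"
    proof (intro add_left_mono sum_mono)
      fix k assume "k \<in> {..<T'}"
      then have "k < T" using T' by simp
      from next_momentum_error[OF p[OF this], of "w k" "m k"]
      show "e (Suc k) \<le> 2 * q * U k + 2 * L\<^sup>2 * a k"
        by (simp add: e_def U_def a_def q_def flip: w_Suc m_Suc)
    qed
    also have "\<dots> \<le> S + (\<Sum>k<T. 2 * q * U k + 2 * L\<^sup>2 * a k)"
    proof (rule add_mono)
      show "G 0 \<le> S"
        unfolding S_def using T by (intro member_le_sum G_nonneg) auto
      show "(\<Sum>k<T'. 2 * q * U k + 2 * L\<^sup>2 * a k) \<le> (\<Sum>k<T. 2 * q * U k + 2 * L\<^sup>2 * a k)"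
        using T' q by (intro sum_mono2) (auto intro!: add_nonneg_nonneg mult_nonneg_nonneg U_nonneg a_nonneg)
    qed
    finally show "E \<le> S + (2 * q * V + 2 * L\<^sup>2 * A)"
      by (simp add: V_def A_def sum.distrib sum_distrib_left)
  qed
  \<comment> \<open>The moves \<open>\<eta> u\<close> are absorbed by the negative term of the descent inequality.\<close>
  moreover have "\<beta> * (2 * q * V) \<le> (1 - L * \<eta>) * V"
  proof -
    have "\<beta> * (2 * q) \<le> 1 * (2 * q)"
      using \<beta>_less q by (intro mult_right_mono) auto
    then have "\<beta> * (2 * q) \<le> 1 - L * \<eta>"
      using q step_le by linarith
    then have "\<beta> * (2 * q) * V \<le> (1 - L * \<eta>) * V"
      by (intro mult_right_mono V_nonneg)
    then show ?thesis by (simp add: mult.assoc)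
  qed
  moreover have "(1 + \<beta>) * (L\<^sup>2 * A) \<le> 2 * (L\<^sup>2 * A)"
    using \<beta>_less A_nonneg by (intro mult_right_mono) auto
  ultimately have main: "(1 - \<beta>) * S \<le> 2 * (F w0 - inf_val n f) / \<eta> + 2 * (L\<^sup>2 * A)"
    by (simp add: algebra_simps)

  \<comment> \<open>It remains to bound the total drift \<open>A\<close>.\<close>
  have "M \<le> 2 * S + 2 * L\<^sup>2 * A"
  proof -
    have "M = (\<Sum>k<T'. (norm (m (Suc k)))\<^sup>2)"
      unfolding M_def T' by (simp add: sum.lessThan_Suc_shift start del: sum.lessThan_Suc)
    also have "\<dots> \<le> (\<Sum>k<T'. 2 * G k + 2 * L\<^sup>2 * a k)"
    proof (rule sum_mono)
      fix k assume "k \<in> {..<T'}"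
      then have "k < T" using T' by simp
      from next_momentum_norm[OF p[OF this], of "w k" "m k"]
      show "(norm (m (Suc k)))\<^sup>2 \<le> 2 * G k + 2 * L\<^sup>2 * a k"
        by (simp add: G_def a_def flip: m_Suc)
    qed
    also have "\<dots> \<le> (\<Sum>k<T. 2 * G k + 2 * L\<^sup>2 * a k)"
      using T' by (intro sum_mono2) (auto intro!: add_nonneg_nonneg mult_nonneg_nonneg G_nonneg a_nonneg)
    finally show ?thesis
      by (simp add: S_def A_def sum.distrib sum_distrib_left)
  qed
  moreover have "(1 - 3 / 2 * q) * A \<le> \<eta>\<^sup>2 * (\<beta> / 3 * M + (1 - \<beta>) * (S + 3 * Q))"
  proof -
    have "(1 - 3 / 2 * q) * A = (\<Sum>k<T. (1 - 3 / 2 * q) * a k)"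
      by (simp add: A_def sum_distrib_left)
    also have "\<dots> \<le> (\<Sum>k<T. \<eta>\<^sup>2 * (\<beta> / 3 * (norm (m k))\<^sup>2 + (1 - \<beta>) * (G k + 3 * R k)))"
      unfolding q_def a_def G_def R_def by (intro sum_mono drift_bound p) auto
    also have "\<dots> = \<eta>\<^sup>2 * (\<beta> / 3 * M + (1 - \<beta>) * (S + 3 * Q))"
      unfolding M_def S_def Q_def by (simp only: sum_distrib_left[symmetric] sum.distrib)
    finally show ?thesis .
  qed
  ultimately have "(1 - 3 / 2 * q) * A
      \<le> \<eta>\<^sup>2 * (\<beta> / 3 * (2 * S + 2 * L\<^sup>2 * A) + (1 - \<beta>) * (S + 3 * Q))"
    using \<beta>_nonneg by (smt (verit) mult_left_mono zero_le_power2 divide_nonneg_pos)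
  then have "L\<^sup>2 * ((1 - 3 / 2 * q) * A)
      \<le> L\<^sup>2 * (\<eta>\<^sup>2 * (\<beta> / 3 * (2 * S + 2 * L\<^sup>2 * A) + (1 - \<beta>) * (S + 3 * Q)))"
    by (rule mult_left_mono) simp
  also have "\<dots> = q * (S + 3 * Q) - q * (\<beta> / 3 * S + 3 * \<beta> * Q) + 2 / 3 * \<beta> * q * (L\<^sup>2 * A)"
    by (simp add: q_def power_mult_distrib algebra_simps)
  also have "\<dots> \<le> q * (S + 3 * Q) + 2 / 3 * q * (L\<^sup>2 * A)"
  proof -
    have "0 \<le> q * (\<beta> / 3 * S + 3 * \<beta> * Q)"
      using q S_nonneg Q_nonneg \<beta>_nonneg by simp
    moreover have "2 / 3 * \<beta> * q * (L\<^sup>2 * A) \<le> 2 / 3 * 1 * q * (L\<^sup>2 * A)"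
      using q \<beta>_less A_nonneg by (intro mult_right_mono mult_left_mono) auto
    ultimately show ?thesis by simp
  qed
  finally have "(1 - 13 / 6 * q) * (L\<^sup>2 * A) \<le> q * (S + 3 * Q)"
    by (simp add: algebra_simps)
  moreover have "3 / 4 * (L\<^sup>2 * A) \<le> (1 - 13 / 6 * q) * (L\<^sup>2 * A)"
    using q A_nonneg by (intro mult_right_mono) auto
  ultimately have "(1 - \<beta>) * S \<le> 2 * (F w0 - inf_val n f) / \<eta> + 8 / 3 * q * (S + 3 * Q)"
    using main by linarith
  then show ?thesis
    unfolding S_def Q_def G_def R_def w_def q_def .
qed

section \<open>Expected shuffling error\<close>

lemma expected_shuffle_error:
  "measure_pmf.expectation (pmf_of_set {p. p permutes {1..n}}) (\<lambda>p. err p w)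
    \<le> (\<Theta> * (norm (gradF w))\<^sup>2 + \<sigma>\<^sup>2) / (2 * real n)"
proof -
  define X where "X i = grad (f i) w - gradF w" for i
  define v where "v = (\<Sum>i = 1..n. (norm (X i))\<^sup>2)"
  have partial: "real n * (\<Sum>p | p permutes {1..n}. (norm (\<Sum>j<i. X (p (Suc j))))\<^sup>2)
      \<le> real i * (fact n * v)" if "i < n" for i
  proof -
    have "(\<Sum>j<i. X (p (Suc j))) = (\<Sum>j = 1..i. X (p j))" for p
      by (rule sum.reindex_bij_witness[where i = "\<lambda>i. i - 1" and j = Suc]) auto
    then show ?thesis
      using sum_permutations_norm_partial_sum[of "{1..n}" "{1..i}" X] that deviations_sum_zero[of w]
      by (simp add: X_def v_def)
  qed
  have "real n * (\<Sum>p | p permutes {1..n}. real n ^ 3 * err p w)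
      = (\<Sum>i<n. real n * (\<Sum>p | p permutes {1..n}. (norm (\<Sum>j<i. X (p (Suc j))))\<^sup>2))"
    using n_pos by (simp add: shuffle_error_def X_def sum_distrib_left sum.swap[of _ "{..<n}"])
  also have "\<dots> \<le> (\<Sum>i<n. real i * (fact n * v))"
    using partial by (intro sum_mono) auto
  also have "\<dots> = (\<Sum>i<n. real i) * (fact n * v)"
    by (simp add: sum_distrib_right)
  also have "\<dots> \<le> real n ^ 2 / 2 * (fact n * v)"
    by (intro mult_right_mono sum_indices) (auto simp: v_def sum_nonneg)
  finally have "real n ^ 4 * (\<Sum>p | p permutes {1..n}. err p w) \<le> real n ^ 2 / 2 * (fact n * v)"
    by (simp add: sum_distrib_left[symmetric] power4_eq_xxxx power3_eq_cube mult.assoc)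
  then have "(\<Sum>p | p permutes {1..n}. err p w) / fact n \<le> (1 / real n * v) / (2 * real n)"
    using n_pos by (simp add: field_simps power4_eq_xxxx power2_eq_square)
  also have "\<dots> \<le> (\<Theta> * (norm (gradF w))\<^sup>2 + \<sigma>\<^sup>2) / (2 * real n)"
    using problem n_pos by (intro divide_right_mono) (auto simp: smg_problem_def v_def X_def)
  finally show ?thesis
    by (subst integral_pmf_of_set)
       (auto simp: finite_permutations card_permutations intro: permutes_id)
qed

text \<open>
  The iterate \<open>w\<^sub>k\<close> is independent of the permutation of epoch \<open>k + 1\<close>, so the bound for a fixed point
  can be integrated over \<open>w\<^sub>k\<close>.
\<close>

lemma expected_shuffle_error_epoch:
  assumes "k < T"
  shows "measure_pmf.expectation (rr_perms n T) (\<lambda>\<pi>. err (\<pi> (Suc k)) (iter \<pi> w0 k))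
    \<le> measure_pmf.expectation (rr_perms n T)
        (\<lambda>\<pi>. (\<Theta> * (norm (gradF (iter \<pi> w0 k)))\<^sup>2 + \<sigma>\<^sup>2) / (2 * real n))"
proof -
  let ?P = "pmf_of_set {p. p permutes {1..n}}"
  let ?Q = "Pi_pmf ({1..T} - {Suc k}) id (\<lambda>_. ?P)"
  have split: "rr_perms n T = map_pmf (\<lambda>(p, \<pi>). \<pi>(Suc k := p)) (pair_pmf ?P ?Q)"
    using assms by (intro rr_perms_split) auto
  have fin: "finite (set_pmf ?P)" "finite (set_pmf ?Q)"
    by (simp_all only: set_pmf_permutations finite_permutations finite_atLeastAtMost)
       (simp add: finite_set_Pi_pmf_permutations[unfolded One_nat_def])
  have past: "iter (\<pi>(Suc k := p)) w0 k = iter \<pi> w0 k" for \<pi> p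
    unfolding smg_iterate_def by (intro arg_cong[where f = fst] smg_outer_cong) auto
  have "measure_pmf.expectation (rr_perms n T) (\<lambda>\<pi>. err (\<pi> (Suc k)) (iter \<pi> w0 k))
      = measure_pmf.expectation ?Q (\<lambda>\<pi>. measure_pmf.expectation ?P (\<lambda>p. err p (iter \<pi> w0 k)))"
    unfolding split by (simp add: case_prod_beta past expectation_pair_pmf_finite fin del: One_nat_def)
  also have "\<dots> \<le> measure_pmf.expectation ?Q
      (\<lambda>\<pi>. (\<Theta> * (norm (gradF (iter \<pi> w0 k)))\<^sup>2 + \<sigma>\<^sup>2) / (2 * real n))"
    by (intro integral_mono expected_shuffle_error integrable_measure_pmf_finite fin)
  also have "\<dots> = measure_pmf.expectation (rr_perms n T)
        (\<lambda>\<pi>. (\<Theta> * (norm (gradF (iter \<pi> w0 k)))\<^sup>2 + \<sigma>\<^sup>2) / (2 * real n))"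
    unfolding split by (simp add: case_prod_beta past expectation_pair_pmf_finite fin del: One_nat_def)
  finally show ?thesis .
qed

lemma expected_trajectory_bound:
  fixes w0 T
  defines "s \<equiv> measure_pmf.expectation (rr_perms n T) (\<lambda>\<pi>. \<Sum>k<T. (norm (gradF (iter \<pi> w0 k)))\<^sup>2)"
  assumes T: "1 \<le> T"
  shows "(1 - \<beta>) * s \<le> 2 * (F w0 - inf_val n f) / \<eta>
      + 4 * (L * \<eta>)\<^sup>2 * ((1 + \<Theta> / real n) * s + real T * \<sigma>\<^sup>2 / real n)"
proof -
  let ?E = "measure_pmf.expectation (rr_perms n T)"
  let ?G = "\<lambda>\<pi> k. (norm (gradF (iter \<pi> w0 k)))\<^sup>2"
  let ?R = "\<lambda>\<pi> k. err (\<pi> (Suc k)) (iter \<pi> w0 k)"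
  have int [simp]: "integrable (measure_pmf (rr_perms n T)) h" for h :: "_ \<Rightarrow> real"
    by (intro integrable_measure_pmf_finite finite_set_rr_perms)
  define r where "r = ?E (\<lambda>\<pi>. \<Sum>k<T. ?R \<pi> k)"
  have "r = (\<Sum>k<T. ?E (\<lambda>\<pi>. ?R \<pi> k))"
    by (simp add: r_def)
  also have "\<dots> \<le> (\<Sum>k<T. ?E (\<lambda>\<pi>. (\<Theta> * ?G \<pi> k + \<sigma>\<^sup>2) / (2 * real n)))"
    by (intro sum_mono expected_shuffle_error_epoch) auto
  also have "\<dots> = (\<Theta> * s + real T * \<sigma>\<^sup>2) / (2 * real n)"
    by (simp add: s_def sum.distrib sum_distrib_left flip: sum_divide_distrib)
  finally have r: "r \<le> (\<Theta> * s + real T * \<sigma>\<^sup>2) / (2 * real n)" .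
  have "0 \<le> s"
    unfolding s_def by (intro Bochner_Integration.integral_nonneg sum_nonneg) auto
  have "(1 - \<beta>) * s = ?E (\<lambda>\<pi>. (1 - \<beta>) * (\<Sum>k<T. ?G \<pi> k))"
    by (simp add: s_def)
  also have "\<dots> \<le> ?E (\<lambda>\<pi>. 2 * (F w0 - inf_val n f) / \<eta>
      + 8 / 3 * (L * \<eta>)\<^sup>2 * ((\<Sum>k<T. ?G \<pi> k) + 3 * (\<Sum>k<T. ?R \<pi> k)))"
    by (intro integral_mono_AE int AE_pmfI trajectory_bound T rr_perms_permutes)
  also have "\<dots> = 2 * (F w0 - inf_val n f) / \<eta> + 8 / 3 * (L * \<eta>)\<^sup>2 * (s + 3 * r)"
    by (simp add: s_def r_def del: Bochner_Integration.integral_sum)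
  also have "\<dots> \<le> 2 * (F w0 - inf_val n f) / \<eta>
      + 8 / 3 * (L * \<eta>)\<^sup>2 * (3 / 2 * ((1 + \<Theta> / real n) * s + real T * \<sigma>\<^sup>2 / real n))"
  proof (intro add_left_mono mult_left_mono)
    have "3 / 2 * ((1 + \<Theta> / real n) * s + real T * \<sigma>\<^sup>2 / real n)
        = 3 / 2 * s + 3 * ((\<Theta> * s + real T * \<sigma>\<^sup>2) / (2 * real n))"
      using n_pos by (simp add: field_simps)
    then show "s + 3 * r \<le> 3 / 2 * ((1 + \<Theta> / real n) * s + real T * \<sigma>\<^sup>2 / real n)"
      using r \<open>0 \<le> s\<close> by linarith
  qed simp
  also have "8 / 3 * (L * \<eta>)\<^sup>2 * (3 / 2 * x) = 4 * (L * \<eta>)\<^sup>2 * x" for x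
    by simp
  finally show ?thesis .
qed

end

section \<open>Step sizes and the convergence rate\<close>

text \<open>
  For a constant step size the returned epoch is uniformly distributed.
\<close>

lemma expected_sq_grad_eq_average:
  assumes T: "1 \<le> T" and pos: "0 < step_size n \<gamma> T"
  shows "expected_sq_grad n f \<beta> \<gamma> T w0
    = measure_pmf.expectation (rr_perms n T) (\<lambda>\<pi>. \<Sum>k<T.
        (norm (grad (avg_fun n f) (smg_iterate n f \<beta> (\<lambda>_. step_size n \<gamma> T) \<pi> w0 k)))\<^sup>2) / real T"
proof -
  define \<eta> where "\<eta> = step_size n \<gamma> T"
  define h where "h \<pi> k = (norm (grad (avg_fun n f) (smg_iterate n f \<beta> (\<lambda>_. \<eta>) \<pi> w0 k)))\<^sup>2" for \<pi> k
  have pmf: "pmf (output_index (\<lambda>_. \<eta>) T) t = (if t \<in> {1..T} then 1 / real T else 0)" for t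
    using T pos by (subst pmf_output_index) (auto simp: \<eta>_def)
  have supp: "t \<in> {1..T}" if "t \<in> set_pmf (output_index (\<lambda>_. \<eta>) T)" for t
    using that pmf[of t] by (auto simp: set_pmf_iff split: if_splits)
  then have fin: "finite (set_pmf (output_index (\<lambda>_. \<eta>) T))"
    by (meson finite_atLeastAtMost finite_subset subsetI)
  have index: "measure_pmf.expectation (output_index (\<lambda>_. \<eta>) T) (\<lambda>t. h \<pi> (t - 1))
      = (\<Sum>k<T. h \<pi> k) / real T" for \<pi>
  proof -
    have "measure_pmf.expectation (output_index (\<lambda>_. \<eta>) T) (\<lambda>t. h \<pi> (t - 1))
        = (\<Sum>t = 1..T. h \<pi> (t - 1) * pmf (output_index (\<lambda>_. \<eta>) T) t)"
      by (rule integral_measure_pmf_real) (use supp in auto)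
    also have "\<dots> = (\<Sum>t = 1..T. h \<pi> (t - 1)) / real T"
      by (simp add: pmf sum_divide_distrib)
    also have "(\<Sum>t = 1..T. h \<pi> (t - 1)) = (\<Sum>k<T. h \<pi> k)"
      by (rule sum.reindex_bij_witness[where i = Suc and j = "\<lambda>t. t - 1"]) auto
    finally show ?thesis .
  qed
  have "expected_sq_grad n f \<beta> \<gamma> T w0
      = measure_pmf.expectation (pair_pmf (rr_perms n T) (output_index (\<lambda>_. \<eta>) T)) (\<lambda>z. h (fst z) (snd z - 1))"
    by (simp add: expected_sq_grad_def smg_output_def h_def case_prod_beta flip: \<eta>_def)
  also have "\<dots> = measure_pmf.expectation (rr_perms n T)
      (\<lambda>\<pi>. measure_pmf.expectation (output_index (\<lambda>_. \<eta>) T) (\<lambda>t. h \<pi> (t - 1)))"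
    by (subst pair_commute_pmf)
       (simp add: case_prod_beta expectation_pair_pmf_finite fin finite_set_rr_perms)
  also have "\<dots> = measure_pmf.expectation (rr_perms n T) (\<lambda>\<pi>. \<Sum>k<T. h \<pi> k) / real T"
    unfolding index by (rule integral_divide_zero)
  finally show ?thesis
    by (simp add: h_def \<eta>_def)
qed

lemma step_size_pos: "1 \<le> n \<Longrightarrow> 1 \<le> T \<Longrightarrow> 0 < \<gamma> \<Longrightarrow> 0 < step_size n \<gamma> T"
  by (simp add: step_size_def)

lemma step_size_powers:
  assumes "1 \<le> n" "1 \<le> T"
  shows "step_size n \<gamma> T * real T = \<gamma> * (real n powr (1/3) * real T powr (2/3))"
    and "(step_size n \<gamma> T)\<^sup>2 / real n = \<gamma>\<^sup>2 / (real n powr (1/3) * real T powr (2/3))"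
proof -
  have T: "real T = real T powr (1/3) * real T powr (2/3)"
    using assms by (simp flip: powr_add)
  have n: "real n = real n powr (1/3) * real n powr (1/3) * real n powr (1/3)"
    using assms by (simp flip: powr_add)
  have T2: "real T powr (2/3) = real T powr (1/3) * real T powr (1/3)"
    by (simp flip: powr_add)
  have pos: "0 < real n powr (1/3)" "0 < real T powr (1/3)"
    using assms by auto
  define a b where "a = real n powr (1/3)" and "b = real T powr (1/3)"
  show "step_size n \<gamma> T * real T = \<gamma> * (real n powr (1/3) * real T powr (2/3))"
    using pos by (subst T) (simp add: step_size_def)
  have "(\<gamma> * a / b)\<^sup>2 / (a * a * a) = \<gamma>\<^sup>2 / (a * (b * b))"
    using pos by (simp add: a_def[symmetric] b_def[symmetric] power2_eq_square field_simps)
  then show "(step_size n \<gamma> T)\<^sup>2 / real n = \<gamma>\<^sup>2 / (real n powr (1/3) * real T powr (2/3))"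
    unfolding step_size_def T2 a_def b_def n[symmetric] .
qed

text \<open>
  The first bound holds because \<open>(5 - 3 \<beta>) / (1 - \<beta>) \<ge> 5\<close> forces \<open>D \<ge> 30\<close>.  The second absorbs the
  gradient terms in \<open>expected_trajectory_bound\<close>; it uses only \<open>5 - 3 \<beta> \<ge> 2\<close>.
\<close>

lemma step_condition:
  assumes "0 < L" "0 \<le> \<Theta>" "0 \<le> \<beta>" "\<beta> < 1" "1 \<le> n" "0 < \<eta>"
    and step: "\<eta> \<le> 1 / (L * sqrt (smg_D n \<beta> \<Theta>))"
  shows "30 * (L * \<eta>)\<^sup>2 \<le> 1"
    and "12 * ((L * \<eta>)\<^sup>2 * (1 + \<Theta> / real n)) \<le> 1 - \<beta>"
proof -
  let ?D = "smg_D n \<beta> \<Theta>"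
  have D: "5 / 3 \<le> ?D" "6 * (5 - 3 * \<beta>) * (\<Theta> + real n) / (real n * (1 - \<beta>)) \<le> ?D"
    by (simp_all add: smg_D_def)
  have "L * \<eta> * sqrt ?D \<le> 1"
    using step assms D by (simp add: field_simps)
  then have "(L * \<eta> * sqrt ?D)\<^sup>2 \<le> 1"
    using assms D by (intro power_le_one) auto
  then have q: "(L * \<eta>)\<^sup>2 * ?D \<le> 1"
    using D by (simp add: power_mult_distrib)
  have frac: "6 * (5 - 3 * \<beta>) * (\<Theta> + real n) / (real n * (1 - \<beta>))
      = 6 * ((5 - 3 * \<beta>) / (1 - \<beta>)) * (1 + \<Theta> / real n)"
    using assms by (simp add: field_simps)
  have ratio: "5 \<le> (5 - 3 * \<beta>) / (1 - \<beta>)" "2 / (1 - \<beta>) \<le> (5 - 3 * \<beta>) / (1 - \<beta>)"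
    using assms by (simp add: pos_le_divide_eq) (intro divide_right_mono, use assms in auto)
  have "6 * 5 * 1 \<le> 6 * ((5 - 3 * \<beta>) / (1 - \<beta>)) * (1 + \<Theta> / real n)"
    using ratio(1) assms by (intro mult_mono) auto
  then have "30 \<le> ?D"
    using D(2) frac by linarith
  then have "(L * \<eta>)\<^sup>2 * 30 \<le> (L * \<eta>)\<^sup>2 * ?D"
    by (intro mult_left_mono) auto
  then show "30 * (L * \<eta>)\<^sup>2 \<le> 1"
    using q by linarith
  have "6 * (2 / (1 - \<beta>)) * (1 + \<Theta> / real n) \<le> 6 * ((5 - 3 * \<beta>) / (1 - \<beta>)) * (1 + \<Theta> / real n)"
    using ratio(2) assms by (intro mult_right_mono mult_left_mono) auto
  then have "6 * (2 / (1 - \<beta>)) * (1 + \<Theta> / real n) \<le> ?D"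
    using D(2) frac by linarith
  then have "(L * \<eta>)\<^sup>2 * (6 * (2 / (1 - \<beta>)) * (1 + \<Theta> / real n)) \<le> (L * \<eta>)\<^sup>2 * ?D"
    by (intro mult_left_mono) auto
  then have "(L * \<eta>)\<^sup>2 * (6 * (2 / (1 - \<beta>)) * (1 + \<Theta> / real n)) \<le> 1"
    using q by linarith
  also have "(L * \<eta>)\<^sup>2 * (6 * (2 / (1 - \<beta>)) * (1 + \<Theta> / real n))
      = 12 * ((L * \<eta>)\<^sup>2 * (1 + \<Theta> / real n)) / (1 - \<beta>)"
    by simp
  finally show "12 * ((L * \<eta>)\<^sup>2 * (1 + \<Theta> / real n)) \<le> 1 - \<beta>"
    using assms by simp
qed

lemma expected_sq_grad_bound:
  fixes f :: "nat \<Rightarrow> 'a::euclidean_space \<Rightarrow> real"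
  assumes pos: "0 < L" "0 \<le> \<Theta>" "0 \<le> \<beta>" "\<beta> < 1" "0 < \<gamma>"
    and problem: "smg_problem n f L \<Theta> \<sigma>" and T: "1 \<le> T"
    and step: "step_size n \<gamma> T \<le> 1 / (L * sqrt (smg_D n \<beta> \<Theta>))"
  shows "expected_sq_grad n f \<beta> \<gamma> T w0
    \<le> 1 / (real n powr (1/3) * real T powr (2/3)) *
       (4 * (avg_fun n f w0 - inf_val n f) / ((1 - \<beta>) * \<gamma>)
        + 6 * \<sigma>\<^sup>2 * (5 - 3 * \<beta>) * L\<^sup>2 * \<gamma>\<^sup>2 / (1 - \<beta>))"
proof -
  define \<eta> where "\<eta> = step_size n \<gamma> T"
  have n: "1 \<le> n"
    using problem by (simp add: smg_problem_def)
  have \<eta>: "0 < \<eta>"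
    using n T pos by (simp add: \<eta>_def step_size_pos)
  note cond = step_condition[OF pos(1-4) n \<eta> step[folded \<eta>_def]]
  interpret smg n f L \<Theta> \<sigma> \<beta> \<eta>
    by unfold_locales (use problem pos \<eta> cond in auto)
  define s where "s = measure_pmf.expectation (rr_perms n T)
    (\<lambda>\<pi>. \<Sum>k<T. (norm (gradF (iter \<pi> w0 k)))\<^sup>2)"
  define \<Delta> where "\<Delta> = F w0 - inf_val n f"
  define q where "q = (L * \<eta>)\<^sup>2"
  define N where "N = real n powr (1/3) * real T powr (2/3)"
  have \<Delta>: "0 \<le> \<Delta>"
    using average_lower_bound by (simp add: \<Delta>_def)
  have N: "0 < N"
    using n T by (simp add: N_def)
  have s: "0 \<le> s"
    unfolding s_def by (intro Bochner_Integration.integral_nonneg sum_nonneg) auto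
  have "(1 - \<beta>) * s \<le> 2 * \<Delta> / \<eta> + 4 * q * ((1 + \<Theta> / real n) * s + real T * \<sigma>\<^sup>2 / real n)"
    using expected_trajectory_bound[OF T, of w0] by (simp only: s_def \<Delta>_def q_def)
  \<comment> \<open>The step size condition bounds the gradient terms on the right by a third of the left-hand side.\<close>
  moreover have "12 * (q * (1 + \<Theta> / real n)) * s \<le> (1 - \<beta>) * s"
    using cond(2) s unfolding q_def by (rule mult_right_mono)
  moreover have "4 * q * ((1 + \<Theta> / real n) * s + real T * \<sigma>\<^sup>2 / real n)
      = 1 / 3 * (12 * (q * (1 + \<Theta> / real n)) * s) + 4 * q * (real T * \<sigma>\<^sup>2 / real n)"
    by (simp add: algebra_simps)
  ultimately have "2 / 3 * ((1 - \<beta>) * s) \<le> 2 * \<Delta> / \<eta> + 4 * q * (real T * \<sigma>\<^sup>2 / real n)"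
    by linarith
  then have "(1 - \<beta>) * s \<le> 3 * \<Delta> / \<eta> + 6 * q * (real T * \<sigma>\<^sup>2 / real n)"
    by simp
  then have "(1 - \<beta>) * s / real T \<le> (3 * \<Delta> / \<eta> + 6 * q * (real T * \<sigma>\<^sup>2 / real n)) / real T"
    by (rule divide_right_mono) simp
  also have "\<dots> = 3 * \<Delta> / (\<eta> * real T) + 6 * \<sigma>\<^sup>2 * L\<^sup>2 * (\<eta>\<^sup>2 / real n)"
    using T n by (simp add: q_def field_simps power_mult_distrib)
  also have "\<dots> = 3 * \<Delta> / (\<gamma> * N) + 6 * \<sigma>\<^sup>2 * L\<^sup>2 * (\<gamma>\<^sup>2 / N)"
    using step_size_powers[OF n T] by (simp add: \<eta>_def N_def)
  also have "\<dots> \<le> 4 * \<Delta> / (\<gamma> * N) + 6 * \<sigma>\<^sup>2 * (5 - 3 * \<beta>) * L\<^sup>2 * (\<gamma>\<^sup>2 / N)"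
  proof (rule add_mono)
    show "3 * \<Delta> / (\<gamma> * N) \<le> 4 * \<Delta> / (\<gamma> * N)"
      using \<Delta> N pos by (intro divide_right_mono) auto
    have "6 * \<sigma>\<^sup>2 * 1 * L\<^sup>2 * (\<gamma>\<^sup>2 / N) \<le> 6 * \<sigma>\<^sup>2 * (5 - 3 * \<beta>) * L\<^sup>2 * (\<gamma>\<^sup>2 / N)"
      using N pos by (intro mult_right_mono mult_left_mono) auto
    then show "6 * \<sigma>\<^sup>2 * L\<^sup>2 * (\<gamma>\<^sup>2 / N) \<le> 6 * \<sigma>\<^sup>2 * (5 - 3 * \<beta>) * L\<^sup>2 * (\<gamma>\<^sup>2 / N)"
      by simp
  qed
  finally have "s / real T \<le> (4 * \<Delta> / (\<gamma> * N) + 6 * \<sigma>\<^sup>2 * (5 - 3 * \<beta>) * L\<^sup>2 * (\<gamma>\<^sup>2 / N)) / (1 - \<beta>)"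
    using pos by (simp add: pos_le_divide_eq mult.commute)
  also have "\<dots> = 1 / N * (4 * \<Delta> / ((1 - \<beta>) * \<gamma>) + 6 * \<sigma>\<^sup>2 * (5 - 3 * \<beta>) * L\<^sup>2 * \<gamma>\<^sup>2 / (1 - \<beta>))"
    using pos N by (simp add: add_divide_distrib distrib_left mult_ac)
  finally show ?thesis
    using expected_sq_grad_eq_average[OF T \<eta>[unfolded \<eta>_def], of f \<beta> w0]
    by (simp add: s_def \<Delta>_def N_def \<eta>_def)
qed

lemma rate_eq: "1 / (real n powr (1/3) * real T powr (2/3)) = real n powr (-1/3) * real T powr (-2/3)"
  using powr_minus_divide[of "real n" "1/3"] powr_minus_divide[of "real T" "2/3"] by simp

lemma step_size_tendsto_0: "(\<lambda>T. step_size n \<gamma> T) \<longlonglongrightarrow> 0"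
proof -
  have "(\<lambda>T. real T powr (-(1/3))) \<longlonglongrightarrow> 0"
    by (intro tendsto_neg_powr filterlim_real_sequentially) simp
  then have "(\<lambda>T. \<gamma> * real n powr (1/3) * real T powr (-(1/3))) \<longlonglongrightarrow> \<gamma> * real n powr (1/3) * 0"
    by (intro tendsto_mult tendsto_const)
  then show ?thesis
    unfolding step_size_def[abs_def] powr_minus_divide by simp
qed

lemma smg_D_pos: "0 < smg_D n \<beta> \<Theta>"
  by (simp add: smg_D_def less_max_iff_disj)

theorem corollary5:
  fixes L \<Theta> \<sigma> \<beta> \<gamma> :: real
  assumes "L > 0" and "\<Theta> \<ge> 0" and "\<sigma> \<ge> 0" and "0 \<le> \<beta>" and "\<beta> < 1" and "\<gamma> > 0"
  shows
    "(\<forall>(n::nat) (f :: nat \<Rightarrow> real ^ 'd \<Rightarrow> real) (T::nat) (w0 :: real ^ 'd).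
       smg_problem n f L \<Theta> \<sigma> \<and> T \<ge> 1 \<and> step_size n \<gamma> T \<le> 1 / (L * sqrt (smg_D n \<beta> \<Theta>)) \<longrightarrow>
       expected_sq_grad n f \<beta> \<gamma> T w0
         \<le> 1 / (real n powr (1/3) * real T powr (2/3)) *
            (4 * (avg_fun n f w0 - inf_val n f) / ((1 - \<beta>) * \<gamma>)
             + 6 * \<sigma>\<^sup>2 * (5 - 3 * \<beta>) * L\<^sup>2 * \<gamma>\<^sup>2 / (1 - \<beta>))) \<and>
    (\<forall>\<Delta>. \<exists>C. \<forall>(n::nat) (f :: nat \<Rightarrow> real ^ 'd \<Rightarrow> real) (T::nat) (w0 :: real ^ 'd).
       smg_problem n f L \<Theta> \<sigma> \<and> avg_fun n f w0 - inf_val n f \<le> \<Delta> \<and>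
       T \<ge> 1 \<and> step_size n \<gamma> T \<le> 1 / (L * sqrt (smg_D n \<beta> \<Theta>)) \<longrightarrow>
       expected_sq_grad n f \<beta> \<gamma> T w0 \<le> C * (real n powr (-1/3) * real T powr (-2/3))) \<and>
    (\<forall>(n::nat) (f :: nat \<Rightarrow> real ^ 'd \<Rightarrow> real) (w0 :: real ^ 'd).
       smg_problem n f L \<Theta> \<sigma> \<longrightarrow>
       (\<lambda>T. expected_sq_grad n f \<beta> \<gamma> T w0) \<in> O(\<lambda>T. real n powr (-1/3) * real T powr (-2/3)))"
proof -
  \<comment> \<open>The constant is nondecreasing in the initial gap, which makes the rate uniform over bounded gaps.\<close>
  define C where "C \<Delta> = 4 * \<Delta> / ((1 - \<beta>) * \<gamma>) + 6 * \<sigma>\<^sup>2 * (5 - 3 * \<beta>) * L\<^sup>2 * \<gamma>\<^sup>2 / (1 - \<beta>)" for \<Delta>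
  have bound: "expected_sq_grad n f \<beta> \<gamma> T w0
      \<le> 1 / (real n powr (1/3) * real T powr (2/3)) * C (avg_fun n f w0 - inf_val n f)"
    if "smg_problem n f L \<Theta> \<sigma>" "T \<ge> 1" "step_size n \<gamma> T \<le> 1 / (L * sqrt (smg_D n \<beta> \<Theta>))"
    for n T and f :: "nat \<Rightarrow> real ^ 'd \<Rightarrow> real" and w0
    unfolding C_def using assms that by (intro expected_sq_grad_bound)
  have mono: "C \<Delta> \<le> C \<Delta>'" if "\<Delta> \<le> \<Delta>'" for \<Delta> \<Delta>'
    unfolding C_def using assms that
    by (intro add_right_mono divide_right_mono mult_left_mono) auto
  have uniform: "expected_sq_grad n f \<beta> \<gamma> T w0 \<le> C \<Delta> * (real n powr (-1/3) * real T powr (-2/3))"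
    if "smg_problem n f L \<Theta> \<sigma>" "avg_fun n f w0 - inf_val n f \<le> \<Delta>" "T \<ge> 1"
      "step_size n \<gamma> T \<le> 1 / (L * sqrt (smg_D n \<beta> \<Theta>))"
    for n T \<Delta> and f :: "nat \<Rightarrow> real ^ 'd \<Rightarrow> real" and w0
  proof -
    note bound[OF that(1,3,4), of w0, unfolded rate_eq]
    also have "real n powr (-1/3) * real T powr (-2/3) * C (avg_fun n f w0 - inf_val n f)
        \<le> real n powr (-1/3) * real T powr (-2/3) * C \<Delta>"
      by (intro mult_left_mono mono that) auto
    finally show ?thesis
      by (simp only: mult.commute)
  qed
  have bigo: "(\<lambda>T. expected_sq_grad n f \<beta> \<gamma> T w0) \<in> O(\<lambda>T. real n powr (-1/3) * real T powr (-2/3))"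
    if problem: "smg_problem n f L \<Theta> \<sigma>" for n and f :: "nat \<Rightarrow> real ^ 'd \<Rightarrow> real" and w0
  proof (rule bigoI)
    \<comment> \<open>The step size tends to \<open>0\<close>, so the step condition holds for all large \<open>T\<close>.\<close>
    have "0 < 1 / (L * sqrt (smg_D n \<beta> \<Theta>))"
      using assms smg_D_pos by simp
    then have "\<forall>\<^sub>F T in sequentially. step_size n \<gamma> T < 1 / (L * sqrt (smg_D n \<beta> \<Theta>))"
      by (rule order_tendstoD(2)[OF step_size_tendsto_0])
    with eventually_ge_at_top[of 1]
    show "\<forall>\<^sub>F T in sequentially. norm (expected_sq_grad n f \<beta> \<gamma> T w0)
        \<le> C (avg_fun n f w0 - inf_val n f) * norm (real n powr (-1/3) * real T powr (-2/3))"
    proof eventually_elim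
      case (elim T)
      have "0 \<le> expected_sq_grad n f \<beta> \<gamma> T w0"
        unfolding expected_sq_grad_def by (intro Bochner_Integration.integral_nonneg) simp
      then show ?case
        using uniform[OF problem order_refl, of T w0] elim by simp
    qed
  qed
  show ?thesis
    using bound uniform bigo unfolding C_def by blast
qed

end
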